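(* Let $n\ge 1$ be an integer. There is a bijection between the set of domino tilings of the Aztec diamond of order $n$ and the set of $n$-tuples $(\pi_1,\dots,\pi_n)$ of large Schröder paths satisfying the following two conditions: (A1) the path $\pi_i$ goes from $(-2i+1,0)$ to $(2i-1,0)$, for $1\le i\le n$; and (A2) any two paths $\pi_i$ and $\pi_j$ with $i\neq j$ do not intersect.
   Context: The Aztec diamond of order $n$ is the union of all the unit squares in the plane with integral corners $(x,y)$ (all four corners) satisfying $|x|+|y|\le n+1$. A domino is a $1\times 2$ or $2\times 1$ (axis-parallel) rectangle with integral corners. A domino tiling of a region $R$ is a set of non-overlapping dominos (i.e. with pairwise disjoint interiors) whose union is $R$. A large Schröder path is a lattice path in $\mathbb{Z}\times\mathbb{Z}$ between two points of the $x$-axis using up steps $(1,1)$, down steps $(1,-1)$ and level steps $(2,0)$ that never passes below the $x$-axis. Two paths intersect if they have a point in common. *)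

theory Defs
  imports "HOL-Analysis.Analysis"
begin

definition unit_square :: "int \<Rightarrow> int \<Rightarrow> (real \<times> real) set" where
  "unit_square a b = {of_int a .. of_int a + 1} \<times> {of_int b .. of_int b + 1}"

definition aztec_diamond :: "nat \<Rightarrow> (real \<times> real) set" where
  "aztec_diamond n =
     \<Union>{unit_square a b | a b. \<forall>x\<in>{a, a + 1}. \<forall>y\<in>{b, b + 1}. \<bar>x\<bar> + \<bar>y\<bar> \<le> int n + 1}"

definition is_domino :: "(real \<times> real) set \<Rightarrow> bool" where
  "is_domino D \<longleftrightarrow> (\<exists>a b :: int.
     D = {of_int a .. of_int a + 2} \<times> {of_int b .. of_int b + 1} \<or>
     D = {of_int a .. of_int a + 1} \<times> {of_int b .. of_int b + 2})"

definition is_domino_tiling :: "(real \<times> real) set \<Rightarrow> (real \<times> real) set set \<Rightarrow> bool" where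
  "is_domino_tiling R T \<longleftrightarrow>
     (\<forall>D\<in>T. is_domino D) \<and>
     pairwise (\<lambda>D E. interior D \<inter> interior E = {}) T \<and>
     \<Union>T = R"

text \<open>A lattice path is represented by the list of the lattice points at which its steps
  start and end; consecutive entries differ by one step.\<close>

definition large_schroeder_path :: "(int \<times> int) list \<Rightarrow> bool" where
  "large_schroeder_path p \<longleftrightarrow>
     p \<noteq> [] \<and>
     successively (\<lambda>u v. v - u \<in> {(1, 1), (1, -1), (2, 0)}) p \<and>
     snd (hd p) = 0 \<and> snd (last p) = 0 \<and>
     (\<forall>(x, y)\<in>set p. 0 \<le> y)"

definition path_from_to :: "(int \<times> int) list \<Rightarrow> int \<times> int \<Rightarrow> int \<times> int \<Rightarrow> bool" where
  "path_from_to p u v \<longleftrightarrow> hd p = u \<and> last p = v"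

text \<open>The midpoint of a level step is not an entry of the list. For paths whose points all
  have the same parity of \<open>x + y\<close> (as is the case when all start at \<open>(x, 0)\<close> with \<open>x\<close> odd),
  the polygonal curves drawn in the plane meet only if the paths have a common entry.\<close>

definition paths_intersect :: "(int \<times> int) list \<Rightarrow> (int \<times> int) list \<Rightarrow> bool" where
  "paths_intersect p q \<longleftrightarrow> set p \<inter> set q \<noteq> {}"

definition nonintersecting_path_tuples :: "nat \<Rightarrow> (nat \<Rightarrow> (int \<times> int) list) set" where
  "nonintersecting_path_tuples n =
     {\<pi> \<in> {1..n} \<rightarrow>\<^sub>E {p. large_schroeder_path p}.
        (\<forall>i\<in>{1..n}. path_from_to (\<pi> i) (- 2 * int i + 1, 0) (2 * int i - 1, 0)) \<and>
        (\<forall>i\<in>{1..n}. \<forall>j\<in>{1..n}. i \<noteq> j \<longrightarrow> \<not> paths_intersect (\<pi> i) (\<pi> j))}"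

end

theory Submission
  imports Defs
begin

text \<open>
  Tilings and tuples of paths are both encoded by the same finite object, a bijection between two
  sets of lattice points that moves every point by a Schroeder step or not at all.

  Rows of the diamond are renumbered from \<open>0\<close>, and the lattice point \<open>(x, y)\<close> stands for the midpoint
  of the vertical unit edge at abscissa \<open>x\<close> in row \<open>y\<close>.  Only points with \<open>x + y\<close> odd are used; each of
  them lies between a cell on its left and a cell on its right, and every cell of the plane is the
  left or the right cell of exactly one such point.  Right cells and left cells are the two classes
  of the chessboard colouring, so a domino joins the right cell of a point \<open>p\<close> to the left cell of a
  point \<open>q\<close>, and adjacency of the cells means that \<open>q - p\<close> is one of \<open>(1, 1)\<close> (a vertical domino
  crossed upwards), \<open>(1, -1)\<close> (a vertical domino crossed downwards), \<open>(2, 0)\<close> (a horizontal domino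
  crossed from end to end) or \<open>(0, 0)\<close> (a horizontal domino with the point in its middle).  A tiling
  is thus the same as a bijection from the points whose right cell lies in the diamond
  (\<open>sources\<close>) to those whose left cell does (\<open>targets\<close>) with displacements in that
  list: lemma \<open>bij_betw_tiling_of\<close>.

  Such a bijection is a union of fixed points and of chains from \<open>sources n - targets n\<close>, the
  points \<open>(-i, i - 1)\<close>, to \<open>targets n - sources n\<close>, the points \<open>(i, i - 1)\<close>.  Prefixing \<open>i - 1\<close> up steps and
  appending down steps until the axis is reached makes Schroeder paths out of the chains.  They are
  pairwise disjoint because the map is injective, and the planarity argument \<open>noncrossing\<close> shows
  that the \<open>i\<close>-th path from the inside ends at the \<open>i\<close>-th end point: the end points are met in
  increasing order, and an increasing self-map of \<open>{1..n}\<close> is the identity.  Conversely, in any tuple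
  of disjoint paths with the prescribed end points the first \<open>i - 1\<close> and last \<open>i - 1\<close> steps of the
  \<open>i\<close>-th path are forced (\<open>initial_up_steps\<close>, \<open>final_down_steps\<close>), so the tuple is determined by
  its steps inside the diamond; sending each point of a path to the next one and fixing
  all other points gives back a bijection of the above kind: lemma \<open>bij_betw_matching_of_paths\<close>.
\<close>

section \<open>Tilings as matchings of lattice points\<close>

definition domino_steps :: "(int \<times> int) set" where
  "domino_steps = {(0, 0), (1, 1), (1, -1), (2, 0)}"

text \<open>Points whose right cell lies in the diamond. In the rotated coordinates
  \<open>(x + y, y - x)\<close> the diamond is a square, so this set and the next one are discrete rectangles.\<close>

definition sources :: "nat \<Rightarrow> (int \<times> int) set" where
  "sources n = {(x, y). odd (x + y) \<and> - 1 \<le> x + y \<and> x + y \<le> 2 * int n - 1 \<and>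
     1 \<le> y - x \<and> y - x \<le> 2 * int n - 1}"

definition targets :: "nat \<Rightarrow> (int \<times> int) set" where
  "targets n = {(x, y). odd (x + y) \<and> 1 \<le> x + y \<and> x + y \<le> 2 * int n - 1 \<and>
     - 1 \<le> y - x \<and> y - x \<le> 2 * int n - 1}"

text \<open>The shift by \<open>n\<close> undoes the numbering of the rows of the diamond from \<open>0\<close>.\<close>

definition right_square :: "nat \<Rightarrow> int \<times> int \<Rightarrow> (real \<times> real) set" where
  "right_square n p = unit_square (fst p) (snd p - int n)"

definition left_square :: "nat \<Rightarrow> int \<times> int \<Rightarrow> (real \<times> real) set" where
  "left_square n p = unit_square (fst p - 1) (snd p - int n)"

definition domino_between :: "nat \<Rightarrow> int \<times> int \<Rightarrow> int \<times> int \<Rightarrow> (real \<times> real) set" where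
  "domino_between n p q = right_square n p \<union> left_square n q"

definition step_matchings :: "nat \<Rightarrow> (int \<times> int \<Rightarrow> int \<times> int) set" where
  "step_matchings n = {\<sigma> \<in> sources n \<rightarrow>\<^sub>E targets n.
     bij_betw \<sigma> (sources n) (targets n) \<and> (\<forall>p\<in>sources n. \<sigma> p - p \<in> domino_steps)}"

definition tiling_of :: "nat \<Rightarrow> (int \<times> int \<Rightarrow> int \<times> int) \<Rightarrow> (real \<times> real) set set" where
  "tiling_of n \<sigma> = (\<lambda>p. domino_between n p (\<sigma> p)) ` sources n"

text \<open>A cell belongs to a union of cells iff its centre does, and centres never lie on the
  boundary of a domino; this turns covering and overlapping into statements about integers.\<close>

definition cell_centre :: "int \<Rightarrow> int \<Rightarrow> real \<times> real" where
  "cell_centre a b = (of_int a + 1/2, of_int b + 1/2)"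

lemma half_in_int_interval:
  "of_int a \<le> (of_int c + 1/2 :: real) \<longleftrightarrow> a \<le> c"
  "(of_int c + 1/2 :: real) \<le> of_int a \<longleftrightarrow> c < a"
  "of_int a < (of_int c + 1/2 :: real) \<longleftrightarrow> a \<le> c"
  "(of_int c + 1/2 :: real) < of_int a \<longleftrightarrow> c < a"
  by linarith+

lemma cell_centre_in_box:
  "cell_centre c d \<in> {of_int a .. of_int a'} \<times> {of_int b .. of_int b'} \<longleftrightarrow>
     a \<le> c \<and> c < a' \<and> b \<le> d \<and> d < b'"
  by (auto simp: cell_centre_def half_in_int_interval)

lemma cell_centre_in_unit_square:
  "cell_centre c d \<in> unit_square a b \<longleftrightarrow> c = a \<and> d = b"
  using cell_centre_in_box[of c d a "a + 1" b "b + 1"] by (auto simp: unit_square_def)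

lemma is_domino_box:
  assumes "is_domino D"
  obtains a a' b b' :: int where "D = {of_int a .. of_int a'} \<times> {of_int b .. of_int b'}"
proof -
  from assms obtain a b :: int where
    "D = {of_int a .. of_int (a + 2)} \<times> {of_int b .. of_int (b + 1)} \<or>
     D = {of_int a .. of_int (a + 1)} \<times> {of_int b .. of_int (b + 2)}"
    unfolding is_domino_def by auto
  then show thesis using that by blast
qed

lemma interior_box:
  "interior ({a .. a'} \<times> {b .. b'}) = {a <..< a'} \<times> {b <..< (b' :: real)}" for a a' :: real
  by (simp add: interior_Times)

lemma domino_centre_interior:
  assumes "is_domino D" "cell_centre c d \<in> D"
  shows "cell_centre c d \<in> interior D"
proof -
  obtain a a' b b' :: int where D: "D = {of_int a .. of_int a'} \<times> {of_int b .. of_int b'}"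
    using assms(1) by (rule is_domino_box)
  show ?thesis using assms(2) unfolding D interior_box cell_centre_in_box
    by (auto simp: cell_centre_def half_in_int_interval)
qed

text \<open>If the interiors of two dominoes meet, this yields a cell common to both: an open
  box with integer corners that contains \<open>z\<close> also contains the centre of the cell at the floor of \<open>z\<close>,
  even when coordinates of \<open>z\<close> are integers.\<close>

lemma domino_interior_floor_centre:
  assumes "is_domino D" "z \<in> interior D"
  shows "cell_centre \<lfloor>fst z\<rfloor> \<lfloor>snd z\<rfloor> \<in> D"
proof -
  obtain a a' b b' :: int where D: "D = {of_int a .. of_int a'} \<times> {of_int b .. of_int b'}"
    using assms(1) by (rule is_domino_box)
  show ?thesis using assms(2) unfolding D interior_box cell_centre_in_box
    by (cases z) (auto simp: le_floor_iff floor_less_iff)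
qed

lemma horizontal_domino:
  "{of_int a .. of_int a + 2} \<times> {of_int b .. of_int b + 1} = unit_square a b \<union> unit_square (a + 1) b"
  by (auto simp: unit_square_def)

lemma vertical_domino:
  "{of_int a .. of_int a + 1} \<times> {of_int b .. of_int b + 2} = unit_square a b \<union> unit_square a (b + 1)"
  by (auto simp: unit_square_def)

text \<open>The cell on the right of an odd point is adjacent to exactly four cells; in terms of the
  points that they are left cells of, these are the four displacements in \<open>domino_steps\<close>.\<close>

lemma is_domino_iff:
  "is_domino D \<longleftrightarrow>
     (\<exists>p q. odd (fst p + snd p) \<and> q - p \<in> domino_steps \<and> D = domino_between n p q)"
  (is "_ \<longleftrightarrow> ?R")
proof
  assume "is_domino D"
  then obtain a b where D: "D = unit_square a b \<union> unit_square (a + 1) b \<or>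
      D = unit_square a b \<union> unit_square a (b + 1)"
    unfolding is_domino_def horizontal_domino vertical_domino by blast
  have H: ?R if "odd (fst p + snd p)" "q - p \<in> domino_steps"
      "D = domino_between n p q" for p q
    using that by blast
  \<comment> \<open>The parity of the lower left cell decides whether it is a right cell or a left cell.\<close>
  show ?R
  proof (cases "odd (a + (b + int n))")
    case True
    show ?thesis using D
    proof
      assume "D = unit_square a b \<union> unit_square (a + 1) b"
      then show ?thesis using True
        by (intro H[of "(a, b + int n)" "(a + 2, b + int n)"])
           (auto simp: domino_between_def domino_steps_def zero_prod_def right_square_def left_square_def add.commute)
    next
      assume "D = unit_square a b \<union> unit_square a (b + 1)"
      then show ?thesis using True
        by (intro H[of "(a, b + int n)" "(a + 1, b + 1 + int n)"])
           (auto simp: domino_between_def domino_steps_def zero_prod_def right_square_def left_square_def)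
    qed
  next
    case False
    show ?thesis using D
    proof
      assume "D = unit_square a b \<union> unit_square (a + 1) b"
      then show ?thesis using False
        by (intro H[of "(a + 1, b + int n)" "(a + 1, b + int n)"])
           (auto simp: domino_between_def domino_steps_def zero_prod_def right_square_def left_square_def)
    next
      assume "D = unit_square a b \<union> unit_square a (b + 1)"
      then show ?thesis using False
        by (intro H[of "(a, b + 1 + int n)" "(a + 1, b + int n)"])
           (auto simp: domino_between_def domino_steps_def zero_prod_def right_square_def left_square_def)
    qed
  qed
next
  assume ?R
  then obtain p q where "q - p \<in> domino_steps" "D = domino_between n p q" by blast
  moreover obtain x y where p: "p = (x, y)" by (cases p)
  ultimately consider "D = unit_square (x - 1) (y - int n) \<union> unit_square (x - 1 + 1) (y - int n)"
    | "D = unit_square x (y - int n) \<union> unit_square x (y - int n + 1)"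
    | "D = unit_square x (y - int n - 1) \<union> unit_square x (y - int n - 1 + 1)"
    | "D = unit_square x (y - int n) \<union> unit_square (x + 1) (y - int n)"
    by (cases q) (auto simp: domino_between_def domino_steps_def right_square_def left_square_def algebra_simps Un_commute)
  then show "is_domino D"
    unfolding horizontal_domino[symmetric] vertical_domino[symmetric] is_domino_def
    by cases blast+
qed

lemma centre_in_right_square:
  "cell_centre a b \<in> right_square n p \<longleftrightarrow> p = (a, b + int n)"
  by (cases p) (auto simp: right_square_def cell_centre_in_unit_square)

lemma centre_in_left_square:
  "cell_centre a b \<in> left_square n p \<longleftrightarrow> p = (a + 1, b + int n)"
  by (cases p) (auto simp: left_square_def cell_centre_in_unit_square)

text \<open>The four corner conditions amount to \<open>-1 \<le> x + y \<le> 2 n - 1\<close> and \<open>0 \<le> y - x \<le> 2 n\<close> for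
  the cell right of \<open>(x, y)\<close>. Which of the two alternatives holds depends on the parity of \<open>x + y\<close>, and
  parity also sharpens the bounds.\<close>

lemma aztec_cell_iff:
  "(\<forall>x\<in>{a, a + 1}. \<forall>y\<in>{b, b + 1}. \<bar>x\<bar> + \<bar>y\<bar> \<le> int n + 1) \<longleftrightarrow>
     (a, b + int n) \<in> sources n \<or> (a + 1, b + int n) \<in> targets n"
proof -
  have "(\<forall>x\<in>{a, a + 1}. \<forall>y\<in>{b, b + 1}. \<bar>x\<bar> + \<bar>y\<bar> \<le> int n + 1) \<longleftrightarrow>
     - 1 \<le> a + (b + int n) \<and> a + (b + int n) \<le> 2 * int n - 1 \<and>
     0 \<le> (b + int n) - a \<and> (b + int n) - a \<le> 2 * int n"
    by auto
  also have "\<dots> \<longleftrightarrow> (a, b + int n) \<in> sources n \<or> (a + 1, b + int n) \<in> targets n"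
    unfolding sources_def targets_def mem_Collect_eq prod.case by presburger
  finally show ?thesis .
qed

lemma aztec_diamond_eq:
  "aztec_diamond n = \<Union>(right_square n ` sources n) \<union> \<Union>(left_square n ` targets n)"
proof -
  have "aztec_diamond n = \<Union>{unit_square a b | a b. (a, b + int n) \<in> sources n \<or> (a + 1, b + int n) \<in> targets n}"
    unfolding aztec_diamond_def aztec_cell_iff ..
  also have "\<dots> = \<Union>(right_square n ` sources n) \<union> \<Union>(left_square n ` targets n)" (is "?L = ?R")
  proof
    show "?L \<subseteq> ?R"
    proof
      fix z assume "z \<in> ?L"
      then obtain a b where z: "z \<in> unit_square a b"
        and "(a, b + int n) \<in> sources n \<or> (a + 1, b + int n) \<in> targets n" by blast
      then show "z \<in> ?R"
      proof (elim disjE)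
        assume "(a, b + int n) \<in> sources n"
        then show ?thesis using z by (force simp: right_square_def)
      next
        assume "(a + 1, b + int n) \<in> targets n"
        then show ?thesis using z by (force simp: left_square_def)
      qed
    qed
    show "?R \<subseteq> ?L"
    proof
      fix z assume "z \<in> ?R"
      then consider x y where "(x, y) \<in> sources n" "z \<in> unit_square x (y - int n)"
        | x y where "(x, y) \<in> targets n" "z \<in> unit_square (x - 1) (y - int n)"
        by (auto simp: right_square_def left_square_def)
      then show "z \<in> ?L"
      proof cases
        case 1 then show ?thesis
          by (intro UnionI[of "unit_square x (y - int n)"] CollectI exI[of _ x] exI[of _ "y - int n"]) auto
      next
        case 2 then show ?thesis
          by (intro UnionI[of "unit_square (x - 1) (y - int n)"] CollectI exI[of _ "x - 1"] exI[of _ "y - int n"]) auto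
      qed
    qed
  qed
  finally show ?thesis .
qed

lemma odd_sources: "p \<in> sources n \<Longrightarrow> odd (fst p + snd p)"
  by (auto simp: sources_def)

lemma odd_targets: "p \<in> targets n \<Longrightarrow> odd (fst p + snd p)"
  by (auto simp: targets_def)

definition right_centre :: "nat \<Rightarrow> int \<times> int \<Rightarrow> real \<times> real" where
  "right_centre n p = cell_centre (fst p) (snd p - int n)"

definition left_centre :: "nat \<Rightarrow> int \<times> int \<Rightarrow> real \<times> real" where
  "left_centre n p = cell_centre (fst p - 1) (snd p - int n)"

lemma centre_cases:
  obtains p where "odd (fst p + snd p)" "cell_centre a b = right_centre n p"
    | p where "odd (fst p + snd p)" "cell_centre a b = left_centre n p"
proof (cases "odd (a + (b + int n))")
  case True
  then show ?thesis using that(1)[of "(a, b + int n)"] by (simp add: right_centre_def)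
next
  case False
  then show ?thesis using that(2)[of "(a + 1, b + int n)"] by (simp add: left_centre_def)
qed

lemma right_centre_iff:
  assumes "odd (fst r + snd r)" "odd (fst q + snd q)"
  shows "right_centre n r \<in> domino_between n p q \<longleftrightarrow> r = p"
  using assms by (cases r; cases p; cases q)
    (auto simp: domino_between_def right_centre_def centre_in_right_square centre_in_left_square)

lemma left_centre_iff:
  assumes "odd (fst r + snd r)" "odd (fst p + snd p)"
  shows "left_centre n r \<in> domino_between n p q \<longleftrightarrow> r = q"
  using assms by (cases r; cases p; cases q)
    (auto simp: domino_between_def left_centre_def centre_in_right_square centre_in_left_square)

lemma odd_step:
  "q - p \<in> domino_steps \<Longrightarrow> odd (fst p + snd p) \<Longrightarrow> odd (fst q + snd q)"
  by (cases p; cases q) (auto simp: domino_steps_def; presburger)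

lemma right_centre_in_aztec_diamond:
  assumes "odd (fst r + snd r)"
  shows "right_centre n r \<in> aztec_diamond n \<longleftrightarrow> r \<in> sources n"
proof -
  have "right_centre n r \<in> aztec_diamond n \<longleftrightarrow>
      r \<in> sources n \<or> (fst r + 1, snd r) \<in> targets n"
    by (simp add: aztec_diamond_eq right_centre_def centre_in_right_square centre_in_left_square)
  then show ?thesis using assms odd_targets[of "(fst r + 1, snd r)" n] by auto
qed

lemma left_centre_in_aztec_diamond:
  assumes "odd (fst r + snd r)"
  shows "left_centre n r \<in> aztec_diamond n \<longleftrightarrow> r \<in> targets n"
proof -
  have "left_centre n r \<in> aztec_diamond n \<longleftrightarrow>
      (fst r - 1, snd r) \<in> sources n \<or> r \<in> targets n"
    by (simp add: aztec_diamond_eq left_centre_def centre_in_right_square centre_in_left_square)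
  then show ?thesis using assms odd_sources[of "(fst r - 1, snd r)" n] by auto
qed

lemma step_matchingsD:
  assumes "\<sigma> \<in> step_matchings n"
  shows "\<sigma> \<in> extensional (sources n)" "bij_betw \<sigma> (sources n) (targets n)"
    "\<And>p. p \<in> sources n \<Longrightarrow> \<sigma> p - p \<in> domino_steps"
    "\<And>p. p \<in> sources n \<Longrightarrow> \<sigma> p \<in> targets n"
  using assms unfolding step_matchings_def PiE_def by blast+

text \<open>Injectivity gives disjointness: a cell shared by two dominoes would be the right cell of
  two sources or the left cell of one target with two preimages. Surjectivity gives the covering.\<close>

lemma tiling_of_is_tiling:
  assumes \<sigma>: "\<sigma> \<in> step_matchings n"
  shows "is_domino_tiling (aztec_diamond n) (tiling_of n \<sigma>)"
  unfolding is_domino_tiling_def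
proof (intro conjI)
  note s = step_matchingsD[OF \<sigma>]
  let ?D = "\<lambda>p. domino_between n p (\<sigma> p)"
  have dom: "is_domino (?D p)" if "p \<in> sources n" for p
    using s(3)[OF that] odd_sources[OF that] is_domino_iff[of _ n] by blast
  then show "\<forall>D\<in>tiling_of n \<sigma>. is_domino D" by (auto simp: tiling_of_def)
  show "\<Union>(tiling_of n \<sigma>) = aztec_diamond n"
    unfolding tiling_of_def domino_between_def aztec_diamond_eq bij_betw_imp_surj_on[OF s(2), symmetric] by blast
  have disj: "interior (?D p) \<inter> interior (?D p') = {}"
    if p: "p \<in> sources n" "p' \<in> sources n" "p \<noteq> p'" for p p'
  proof (rule ccontr)
    assume "interior (?D p) \<inter> interior (?D p') \<noteq> {}"
    then obtain z where "z \<in> interior (?D p)" "z \<in> interior (?D p')" by blast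
    then have c: "cell_centre \<lfloor>fst z\<rfloor> \<lfloor>snd z\<rfloor> \<in> ?D p" "cell_centre \<lfloor>fst z\<rfloor> \<lfloor>snd z\<rfloor> \<in> ?D p'"
      using domino_interior_floor_centre dom p by blast+
    have odds: "odd (fst p + snd p)" "odd (fst p' + snd p')"
      "odd (fst (\<sigma> p) + snd (\<sigma> p))" "odd (fst (\<sigma> p') + snd (\<sigma> p'))"
      using p odd_sources odd_targets s(4) by blast+
    have "\<sigma> p \<noteq> \<sigma> p'"
      using bij_betw_imp_inj_on[OF s(2)] p by (auto dest: inj_onD)
    then show False
      using c p(3) odds
      by (rule_tac centre_cases[of "\<lfloor>fst z\<rfloor>" "\<lfloor>snd z\<rfloor>" n]) (metis right_centre_iff left_centre_iff)+
  qed
  show "pairwise (\<lambda>D E. interior D \<inter> interior E = {}) (tiling_of n \<sigma>)"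
    unfolding tiling_of_def pairwise_image using disj by (simp add: pairwise_def)
qed

lemma inj_on_tiling_of: "inj_on (tiling_of n) (step_matchings n)"
proof (rule inj_onI)
  fix \<sigma> \<tau> assume \<sigma>: "\<sigma> \<in> step_matchings n" and \<tau>: "\<tau> \<in> step_matchings n"
    and eq: "tiling_of n \<sigma> = tiling_of n \<tau>"
  note s = step_matchingsD[OF \<sigma>] and t = step_matchingsD[OF \<tau>]
  show "\<sigma> = \<tau>"
  proof (rule extensionalityI[OF s(1) t(1)])
    fix p assume p: "p \<in> sources n"
    let ?D = "domino_between n p (\<sigma> p)"
    have "?D \<in> tiling_of n \<sigma>" using p by (simp add: tiling_of_def)
    then have "?D \<in> tiling_of n \<tau>" by (simp add: eq)
    then obtain p' where p': "p' \<in> sources n" "?D = domino_between n p' (\<tau> p')"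
      unfolding tiling_of_def by blast
    note odds = odd_sources[OF p] odd_sources[OF p'(1)] odd_targets[OF s(4)[OF p]]
      odd_targets[OF t(4)[OF p'(1)]]
    have "p = p'"
      using right_centre_iff[OF odds(1,3)] right_centre_iff[OF odds(1,4)] p'(2) by metis
    moreover have "\<sigma> p = \<tau> p'"
      using left_centre_iff[OF odds(3,1)] left_centre_iff[OF odds(3,2)] p'(2) by metis
    ultimately show "\<sigma> p = \<tau> p" by simp
  qed
qed

lemma tiling_centre_unique:
  assumes "is_domino_tiling R T" "D \<in> T" "E \<in> T" "cell_centre a b \<in> D" "cell_centre a b \<in> E"
  shows "D = E"
proof (rule ccontr)
  assume "D \<noteq> E"
  with assms(1-3) have "interior D \<inter> interior E = {}" "is_domino D" "is_domino E"
    unfolding is_domino_tiling_def by (auto dest: pairwiseD)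
  then show False using domino_centre_interior assms(4,5) by blast
qed

text \<open>Each cell of the diamond lies in exactly one domino of the tiling, so the relation \<open>piece\<close>
  between the two points of a domino is the graph of a bijection.\<close>

lemma tiling_of_surj:
  assumes T: "is_domino_tiling (aztec_diamond n) T"
  shows "\<exists>\<sigma>\<in>step_matchings n. T = tiling_of n \<sigma>"
proof -
  have cover: "\<Union>T = aztec_diamond n" and dom: "\<And>D. D \<in> T \<Longrightarrow> is_domino D"
    using T by (auto simp: is_domino_tiling_def)
  define piece where "piece p q \<longleftrightarrow> odd (fst p + snd p) \<and> q - p \<in> domino_steps \<and>
    domino_between n p q \<in> T" for p q
  have in_T: "\<exists>p q. piece p q \<and> D = domino_between n p q" if "D \<in> T" for D
    using dom[OF that] is_domino_iff[of D n] that unfolding piece_def by blast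
  have odds: "odd (fst p + snd p)" "odd (fst q + snd q)" if "piece p q" for p q
    using that odd_step unfolding piece_def by blast+
  have rc: "right_centre n r \<in> domino_between n p q \<longleftrightarrow> r = p"
    if "piece p q" "odd (fst r + snd r)" for p q r
    using right_centre_iff odds[OF that(1)] that(2) by simp
  have lc: "left_centre n r \<in> domino_between n p q \<longleftrightarrow> r = q"
    if "piece p q" "odd (fst r + snd r)" for p q r
    using left_centre_iff odds[OF that(1)] that(2) by simp
  have ends: "p \<in> sources n" "q \<in> targets n" if pq: "piece p q" for p q
  proof -
    have "domino_between n p q \<subseteq> aztec_diamond n"
      using pq cover unfolding piece_def by blast
    then show "p \<in> sources n" "q \<in> targets n"
      using rc[OF pq odds(1)[OF pq]] lc[OF pq odds(2)[OF pq]]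
        right_centre_in_aztec_diamond[OF odds(1)[OF pq]] left_centre_in_aztec_diamond[OF odds(2)[OF pq]]
      by auto
  qed
  have uniq: "p = p' \<longleftrightarrow> q = q'" if a: "piece p q" "piece p' q'" for p q p' q'
  proof
    note o = odds[OF a(1)] odds[OF a(2)]
    have in_T': "domino_between n p q \<in> T" "domino_between n p' q' \<in> T"
      using a unfolding piece_def by blast+
    {
      assume "p = p'"
      then have "domino_between n p q = domino_between n p' q'"
        using tiling_centre_unique[OF T in_T'] rc[OF a(1) o(1)] rc[OF a(2) o(1)]
        unfolding right_centre_def by blast
      then show "q = q'" using lc[OF a(1) o(2)] lc[OF a(2) o(2)] by simp
    }
    assume "q = q'"
    then have "domino_between n p q = domino_between n p' q'"
      using tiling_centre_unique[OF T in_T'] lc[OF a(1) o(2)] lc[OF a(2) o(2)]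
      unfolding left_centre_def by blast
    then show "p = p'" using rc[OF a(1) o(1)] rc[OF a(2) o(1)] by simp
  qed
  have ex_q: "\<exists>q. piece p q" if p: "p \<in> sources n" for p
  proof -
    have "right_centre n p \<in> \<Union>T"
      using p right_centre_in_aztec_diamond[OF odd_sources[OF p]] cover by simp
    then obtain D where D: "D \<in> T" "right_centre n p \<in> D" by blast
    with in_T obtain p' q where "piece p' q" "D = domino_between n p' q" by blast
    then show ?thesis using rc[of p' q p] odd_sources[OF p] D(2) by blast
  qed
  have ex_p: "\<exists>p. piece p q" if q: "q \<in> targets n" for q
  proof -
    have "left_centre n q \<in> \<Union>T"
      using q left_centre_in_aztec_diamond[OF odd_targets[OF q]] cover by simp
    then obtain D where D: "D \<in> T" "left_centre n q \<in> D" by blast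
    with in_T obtain p q' where "piece p q'" "D = domino_between n p q'" by blast
    then show ?thesis using lc[of p q' q] odd_targets[OF q] D(2) by blast
  qed
  define \<sigma> where "\<sigma> = restrict (\<lambda>p. SOME q. piece p q) (sources n)"
  have \<sigma>: "piece p (\<sigma> p)" if "p \<in> sources n" for p
    using ex_q[OF that] that unfolding \<sigma>_def by (auto intro: someI_ex)
  have "bij_betw \<sigma> (sources n) (targets n)"
    unfolding bij_betw_def
  proof
    show "inj_on \<sigma> (sources n)" using \<sigma> uniq by (meson inj_onI)
    show "\<sigma> ` sources n = targets n"
    proof
      show "\<sigma> ` sources n \<subseteq> targets n" using \<sigma> ends by blast
      show "targets n \<subseteq> \<sigma> ` sources n"
      proof
        fix q assume "q \<in> targets n"
        then obtain p where p: "piece p q" using ex_p by blast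
        then have "p \<in> sources n" using ends by blast
        then show "q \<in> \<sigma> ` sources n" using uniq[OF p \<sigma>] by blast
      qed
    qed
  qed
  moreover have "\<sigma> \<in> extensional (sources n)" by (simp add: \<sigma>_def)
  moreover have "\<sigma> p \<in> targets n" "\<sigma> p - p \<in> domino_steps" if "p \<in> sources n" for p
    using ends \<sigma>[OF that] unfolding piece_def by blast+
  ultimately have "\<sigma> \<in> step_matchings n"
    by (simp add: step_matchings_def PiE_def)
  moreover have "T = tiling_of n \<sigma>"
  proof
    show "T \<subseteq> tiling_of n \<sigma>"
    proof
      fix D assume "D \<in> T"
      with in_T obtain p q where pq: "piece p q" "D = domino_between n p q" by blast
      then have p: "p \<in> sources n" using ends by blast
      then have "q = \<sigma> p" using uniq[OF pq(1) \<sigma>] by blast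
      with p pq(2) show "D \<in> tiling_of n \<sigma>" by (simp add: tiling_of_def)
    qed
    show "tiling_of n \<sigma> \<subseteq> T"
      using \<sigma> unfolding tiling_of_def piece_def by auto
  qed
  ultimately show ?thesis by blast
qed

lemma bij_betw_tiling_of:
  "bij_betw (tiling_of n) (step_matchings n) {T. is_domino_tiling (aztec_diamond n) T}"
proof (rule bij_betw_imageI[OF inj_on_tiling_of])
  show "tiling_of n ` step_matchings n = {T. is_domino_tiling (aztec_diamond n) T}"
    using tiling_of_is_tiling[of _ n] tiling_of_surj[of n] by (auto simp: image_iff)
qed

section \<open>Lattice paths with Schroeder steps\<close>

definition is_step :: "int \<times> int \<Rightarrow> int \<times> int \<Rightarrow> bool" where
  "is_step u v \<longleftrightarrow> v - u \<in> {(1, 1), (1, -1), (2, 0)}"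

lemma is_step_iff:
  "is_step (x, y) (x', y') \<longleftrightarrow>
     x' = x + 1 \<and> y' = y + 1 \<or> x' = x + 1 \<and> y' = y - 1 \<or> x' = x + 2 \<and> y' = y"
  by (auto simp: is_step_def)

text \<open>The strict order generated by the three kinds of steps: no point of a path leaves the quadrant spanned by \<open>(1, 1)\<close> and \<open>(1, -1)\<close> at an earlier point.\<close>

definition in_right_cone :: "int \<times> int \<Rightarrow> int \<times> int \<Rightarrow> bool" where
  "in_right_cone u v \<longleftrightarrow> fst u < fst v \<and> fst u + snd u \<le> fst v + snd v \<and>
     snd v - fst v \<le> snd u - fst u \<and> (odd (fst u + snd u) \<longleftrightarrow> odd (fst v + snd v))"

lemma is_step_in_right_cone: "is_step u v \<Longrightarrow> in_right_cone u v"
  by (cases u; cases v) (auto simp: is_step_iff in_right_cone_def)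

lemma sorted_in_right_cone:
  assumes "successively is_step l"
  shows "sorted_wrt in_right_cone l"
proof -
  have "successively in_right_cone l"
    using assms by (rule successively_mono) (rule is_step_in_right_cone)
  moreover have "transp in_right_cone"
    by (auto simp: transp_def in_right_cone_def)
  ultimately show ?thesis by (simp add: successively_conv_sorted_wrt)
qed

definition consecutive :: "'a list \<Rightarrow> 'a \<Rightarrow> 'a \<Rightarrow> bool" where
  "consecutive l u v \<longleftrightarrow> (\<exists>k. Suc k < length l \<and> l ! k = u \<and> l ! Suc k = v)"

lemma consecutive_successively: "consecutive l u v \<Longrightarrow> successively P l \<Longrightarrow> P u v"
  by (auto simp: consecutive_def successively_conv_nth)

lemma successively_consecutiveI: "(\<And>u v. consecutive l u v \<Longrightarrow> P u v) \<Longrightarrow> successively P l"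
  by (auto simp: consecutive_def successively_conv_nth)

lemma consecutive_mem: "consecutive l u v \<Longrightarrow> u \<in> set l \<and> v \<in> set l"
  by (auto simp: consecutive_def)

lemma ex_successor:
  assumes "u \<in> set l" "u \<noteq> last l"
  shows "\<exists>v. consecutive l u v"
proof -
  obtain k where k: "k < length l" "l ! k = u" using assms(1) by (auto simp: in_set_conv_nth)
  have "Suc k \<noteq> length l"
  proof
    assume "Suc k = length l"
    moreover from this have "l \<noteq> []" by auto
    ultimately have "l ! k = last l" by (simp add: last_conv_nth flip: \<open>Suc k = length l\<close>)
    with k assms(2) show False by simp
  qed
  with k show ?thesis unfolding consecutive_def by (intro exI[of _ "l ! Suc k"] exI[of _ k]) auto
qed

lemma ex_predecessor:
  assumes "v \<in> set l" "v \<noteq> hd l"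
  shows "\<exists>u. consecutive l u v"
proof -
  obtain k where k: "k < length l" "l ! k = v" using assms(1) by (auto simp: in_set_conv_nth)
  with assms have "k \<noteq> 0" by (auto simp: hd_conv_nth intro: gr0I)
  with k show ?thesis unfolding consecutive_def
    by (intro exI[of _ "l ! (k - 1)"] exI[of _ "k - 1"]) auto
qed

lemma nth_in_right_cone:
  assumes "successively is_step l" "i < j" "j < length l"
  shows "in_right_cone (l ! i) (l ! j)"
  using sorted_wrt_nth_less[OF sorted_in_right_cone[OF assms(1)]] assms(2,3) by blast

lemma hd_in_right_cone:
  assumes "successively is_step l" "u \<in> set l" "u \<noteq> hd l"
  shows "in_right_cone (hd l) u"
proof -
  obtain k where k: "k < length l" "l ! k = u" using assms(2) by (auto simp: in_set_conv_nth)
  with assms have "k \<noteq> 0" by (auto simp: hd_conv_nth intro: gr0I)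
  with k assms(1) show ?thesis
    using nth_in_right_cone[of l 0 k] by (cases l) auto
qed

lemma in_right_cone_last:
  assumes "successively is_step l" "u \<in> set l" "u \<noteq> last l"
  shows "in_right_cone u (last l)"
proof -
  obtain k where k: "k < length l" "l ! k = u" using assms(2) by (auto simp: in_set_conv_nth)
  have l: "last l = l ! (length l - 1)" using k by (subst last_conv_nth) auto
  with k assms(3) have "k \<noteq> length l - 1" by auto
  with k assms(1) show ?thesis
    using nth_in_right_cone[of l k "length l - 1"] l by auto
qed

lemma same_column_nth_eq:
  assumes l: "successively is_step l" and ij: "i < length l" "j < length l" "fst (l ! i) = fst (l ! j)"
  shows "i = j"
proof (rule ccontr)
  assume "i \<noteq> j"
  then consider "i < j" | "j < i" by linarith
  then show False
  proof cases
    case 1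
    from nth_in_right_cone[OF l this ij(2)] show False using ij(3) by (simp add: in_right_cone_def)
  next
    case 2
    from nth_in_right_cone[OF l this ij(1)] show False using ij(3) by (simp add: in_right_cone_def)
  qed
qed

lemma same_column_eq:
  assumes "successively is_step l" "u \<in> set l" "v \<in> set l" "fst u = fst v"
  shows "u = v"
  using same_column_nth_eq[OF assms(1)] assms(2-) by (metis in_set_conv_nth)

lemma consecutive_column_le:
  assumes "successively is_step l" "consecutive l u v" "w \<in> set l" "fst u < fst w"
  shows "fst v \<le> fst w"
proof -
  obtain k where k: "Suc k < length l" "l ! k = u" "l ! Suc k = v"
    using assms(2) by (auto simp: consecutive_def)
  obtain j where j: "j < length l" "l ! j = w" using assms(3) by (auto simp: in_set_conv_nth)
  have "\<not> j < k" "j \<noteq> k"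
    using nth_in_right_cone[OF assms(1), of j k] k j assms(4) by (auto simp: in_right_cone_def)
  then have "j = Suc k \<or> Suc k < j" by auto
  then show ?thesis
    using nth_in_right_cone[OF assms(1), of "Suc k" j] k j by (auto simp: in_right_cone_def)
qed

text \<open>Paths are increasing in \<open>x\<close>, so a point one column to the right of \<open>u\<close> leaves no room for
  another successor of \<open>u\<close>.\<close>

lemma consecutive_next_column:
  assumes "successively is_step l" "consecutive l u v" "w \<in> set l" "fst w = fst u + 1"
  shows "v = w"
proof -
  have "fst u < fst v"
    using consecutive_successively[OF assms(2,1)] by (cases u; cases v) (auto simp: is_step_iff)
  moreover have "fst v \<le> fst w"
    using consecutive_column_le[OF assms(1-3)] assms(4) by simp
  ultimately show ?thesis
    using same_column_eq[OF assms(1) _ assms(3)] consecutive_mem[OF assms(2)] assms(4) by simp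
qed

lemma consecutive_unique:
  assumes "successively is_step l"
  shows "consecutive l u v \<Longrightarrow> consecutive l u w \<Longrightarrow> v = w"
    and "consecutive l u w \<Longrightarrow> consecutive l v w \<Longrightarrow> u = v"
proof -
  show "consecutive l u v \<Longrightarrow> consecutive l u w \<Longrightarrow> v = w"
    unfolding consecutive_def using same_column_nth_eq[OF assms] by (metis Suc_lessD)
  show "consecutive l u w \<Longrightarrow> consecutive l v w \<Longrightarrow> u = v"
    unfolding consecutive_def using same_column_nth_eq[OF assms] by (metis Suc_inject)
qed

text \<open>Let the point behind in \<open>x\<close> advance. It can only reach or overtake the other's height by an
  up step from exactly one unit below, and then parity puts the other point one column ahead, so that the
  two would coincide.\<close>

lemma step_below:
  assumes "is_step (x, y) (x1, y1)" "odd (x + y)" "odd (x' + y')" "x \<le> x'" "x' \<le> x + 2" "y < y'"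
    "(x1, y1) \<noteq> (x', y')"
  shows "odd (x1 + y1) \<and> \<bar>x1 - x'\<bar> \<le> 2 \<and> y1 < y'"
  using assms(1)[unfolded is_step_iff]
proof (elim disjE)
  assume x1: "x1 = x + 1 \<and> y1 = y + 1"
  have "y' \<noteq> y + 1"
  proof
    assume y': "y' = y + 1"
    have "x' = x \<or> x' = x + 1 \<or> x' = x + 2" using assms(4,5) by linarith
    with y' assms(2,3) have "x' = x + 1" by auto
    with x1 y' assms(7) show False by simp
  qed
  with x1 assms(2-6) show ?thesis by auto
qed (use assms(2-) in auto)

lemma step_above:
  assumes "is_step (x', y') (x1, y1)" "odd (x + y)" "odd (x' + y')" "x' \<le> x" "x \<le> x' + 2" "y < y'"
    "(x1, y1) \<noteq> (x, y)"
  shows "odd (x1 + y1) \<and> \<bar>x - x1\<bar> \<le> 2 \<and> y < y1"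
  using assms(1)[unfolded is_step_iff]
proof (elim disjE)
  assume x1: "x1 = x' + 1 \<and> y1 = y' - 1"
  have "y' \<noteq> y + 1"
  proof
    assume y': "y' = y + 1"
    have "x = x' \<or> x = x' + 1 \<or> x = x' + 2" using assms(4,5) by linarith
    with y' assms(2,3) have "x = x' + 1" by auto
    with x1 y' assms(7) show False by simp
  qed
  with x1 assms(2-6) show ?thesis by auto
qed (use assms(2-) in auto)

text \<open>Two paths are followed simultaneously, always advancing the one that is behind. Their
  current points then stay within two columns of each other, the lower one strictly below the upper one.
  Since the upper point is above the axis, the lower path must be the first to end.\<close>

lemma noncrossing_aligned:
  assumes "successively is_step (u # p)" "successively is_step (v # q)"
    "set (u # p) \<inter> set (v # q) = {}"
    "odd (fst u + snd u)" "odd (fst v + snd v)"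
    "\<bar>fst u - fst v\<bar> \<le> 2" "snd u < snd v"
    "\<forall>w\<in>set (u # p). 0 \<le> snd w"
    "snd (last (v # q)) = 0" "snd (last (u # p)) = 0"
  shows "fst (last (u # p)) < fst (last (v # q))"
  using assms
proof (induction "length p + length q" arbitrary: u v p q rule: less_induct)
  case less
  obtain x y x' y' where uv: "u = (x, y)" "v = (x', y')" by (cases u; cases v)
  note prems = less.prems[unfolded uv]
  show ?case
  proof (cases "x \<le> x'")
    case True
    show ?thesis
    proof (cases p)
      case Nil
      then have "last (v # q) \<noteq> v" using prems uv by auto
      then have "in_right_cone v (last (v # q))"
        using in_right_cone_last[of "v # q" v] less.prems(2) by auto
      then show ?thesis using True Nil uv by (auto simp: in_right_cone_def)
    next
      case (Cons u1 p')
      obtain x1 y1 where u1: "u1 = (x1, y1)" by (cases u1)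
      have st: "is_step (x, y) (x1, y1)" using prems(1) Cons u1 by simp
      have ne: "(x1, y1) \<noteq> (x', y')" using prems(3) Cons u1 by auto
      have "odd (x1 + y1)" "\<bar>x1 - x'\<bar> \<le> 2"
        "y1 < y'"
        using step_below[OF st _ _ True _ _ ne] prems(4-7) by auto
      then have "fst (last (u1 # p')) < fst (last (v # q))"
        using less.hyps[of p' q u1 v] less.prems Cons u1 uv by auto
      then show ?thesis using Cons by simp
    qed
  next
    case False
    show ?thesis
    proof (cases q)
      case Nil
      then show ?thesis using prems by auto
    next
      case (Cons v1 q')
      obtain x1 y1 where v1: "v1 = (x1, y1)" by (cases v1)
      have st: "is_step (x', y') (x1, y1)" using prems(2) Cons v1 by simp
      have ne: "(x1, y1) \<noteq> (x, y)" using prems(3) Cons v1 by auto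
      have "odd (x1 + y1)" "\<bar>x - x1\<bar> \<le> 2"
        "y < y1"
        using step_above[OF st, of x y] ne prems(4-7) False by auto
      then have "fst (last (u # p)) < fst (last (v1 # q'))"
        using less.hyps[of p q' u v1] less.prems Cons v1 uv by auto
      then show ?thesis using Cons by simp
    qed
  qed
qed

text \<open>Before the two paths can be compared, the path starting further left has to be followed
  until it has passed the start of the other; disjointness and parity make it arrive above the axis.\<close>

lemma noncrossing:
  assumes "successively is_step (u # p)" "successively is_step (v # q)"
    "set (u # p) \<inter> set (v # q) = {}"
    "odd (fst u + snd u)" "odd (fst v + snd v)"
    "fst v < fst u" "snd u = 0" "fst u \<le> fst (last (v # q))"
    "\<forall>w\<in>set (u # p). 0 \<le> snd w" "\<forall>w\<in>set (v # q). 0 \<le> snd w"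
    "snd (last (v # q)) = 0" "snd (last (u # p)) = 0"
  shows "fst (last (u # p)) < fst (last (v # q))"
  using assms
proof (induction q arbitrary: v)
  case Nil
  then show ?case by simp
next
  case (Cons v1 q)
  obtain x y x' y' x1 y1 where uv: "u = (x, y)" "v = (x', y')" "v1 = (x1, y1)"
    by (cases u; cases v; cases v1)
  have st: "is_step (x', y') (x1, y1)" using Cons.prems(2) uv by simp
  have odd: "odd (fst v1 + snd v1)" using st Cons.prems(5) uv by (auto simp: is_step_iff)
  show ?case
  proof (cases "x1 < x")
    case True
    then have "fst (last (u # p)) < fst (last (v1 # q))"
      using Cons.IH[of v1] Cons.prems odd uv by auto
    then show ?thesis by simp
  next
    case False
    have ne: "(x1, y1) \<noteq> (x, y)" using Cons.prems(3) uv by auto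
    have "0 \<le> y'" "0 \<le> y1" "x' < x" "y = 0" "odd x" "odd (x' + y')"
      using Cons.prems uv by auto
    moreover have "y1 \<noteq> 0"
    proof
      assume y1: "y1 = 0"
      then have "odd x1" using odd uv by simp
      moreover have "x1 = x \<or> x1 = x + 1"
        using st[unfolded is_step_iff] False \<open>x' < x\<close> by linarith
      ultimately have "x1 = x" using \<open>odd x\<close> by auto
      with y1 \<open>y = 0\<close> ne show False by simp
    qed
    ultimately have "\<bar>x - x1\<bar> \<le> 2" "y < y1"
      using st[unfolded is_step_iff] False by linarith+
    then have "fst (last (u # p)) < fst (last (v1 # q))"
      using noncrossing_aligned[of u p v1 q] Cons.prems odd uv by auto
    then show ?thesis by simp
  qed
qed

text \<open>The increasing function \<open>f\<close> excludes that one list passes the common last element and returns.\<close>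

lemma iterated_list_unique:
  fixes s :: "'a \<Rightarrow> 'a" and f :: "'a \<Rightarrow> int"
  assumes "successively (\<lambda>u v. v = s u \<and> f u < f v) l" "successively (\<lambda>u v. v = s u \<and> f u < f v) l'"
    "l \<noteq> []" "l' \<noteq> []" "hd l = hd l'" "last l = last l'"
  shows "l = l'"
proof -
  have less: "f u < f (last (v # r))" if "successively (\<lambda>u v. v = s u \<and> f u < f v) (u # v # r)" for u v r
    using that by (induction r arbitrary: u v) (auto intro: less_trans)
  show ?thesis using assms
  proof (induction l arbitrary: l')
    case (Cons u r)
    then obtain r' where l': "l' = u # r'" by (cases l') auto
    have tails: "successively (\<lambda>u v. v = s u \<and> f u < f v) r" "successively (\<lambda>u v. v = s u \<and> f u < f v) r'"
      using Cons.prems(1,2) l' by (auto simp: successively_Cons)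
    show ?case
    proof (cases r)
      case Nil
      have "r' = []"
      proof (rule ccontr)
        assume "r' \<noteq> []"
        then obtain v t where r': "r' = v # t" by (cases r') auto
        then have "f u < f (last (v # t))" using less[of u v t] Cons.prems(2) l' by blast
        moreover have "last (v # t) = u" using Cons.prems(6) Nil l' r' by simp
        ultimately show False by simp
      qed
      then show ?thesis using Nil l' by simp
    next
      case r: (Cons v t)
      then have "r' \<noteq> []" using less[of u v t] Cons.prems l' by auto
      then obtain t' where r': "r' = v # t'" using Cons.prems l' r by (cases r') auto
      have "r = r'"
        by (rule Cons.IH[OF tails]) (use Cons.prems l' r r' in simp_all)
      then show ?thesis using l' by simp
    qed
  qed simp
qed

text \<open>Two orbits of an injective map that share a point also share the points before it, until
  one of the two begins.\<close>

lemma orbit_backtrack: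
  assumes inj: "inj_on s A"
    and l: "successively (\<lambda>u v. u \<in> A \<and> v = s u) l" "successively (\<lambda>u v. u \<in> A \<and> v = s u) l'"
    and "a < length l" "b < length l'" "l ! a = l' ! b" "a \<le> b"
  shows "hd l \<in> set l'"
  using assms(4-)
proof (induction a arbitrary: b)
  case 0
  then show ?case by (cases l) auto
next
  case (Suc a)
  then obtain c where c: "b = Suc c" by (cases b) auto
  have "l ! a \<in> A" "l ! Suc a = s (l ! a)" "l' ! c \<in> A" "l' ! Suc c = s (l' ! c)"
    using l Suc.prems c by (auto simp: successively_conv_nth)
  with inj Suc.prems c have "l ! a = l' ! c" by (auto dest: inj_onD)
  then show ?case using Suc.prems c by (intro Suc.IH[of c]) auto
qed

lemma orbits_meet:
  assumes "inj_on s A"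
    and "successively (\<lambda>u v. u \<in> A \<and> v = s u) l" "successively (\<lambda>u v. u \<in> A \<and> v = s u) l'"
    and "set l \<inter> set l' \<noteq> {}"
  shows "hd l \<in> set l' \<or> hd l' \<in> set l"
proof -
  obtain a b where ab: "a < length l" "b < length l'" "l ! a = l' ! b"
    using assms(4) by (auto simp: in_set_conv_nth) metis
  then show ?thesis
    using orbit_backtrack[OF assms(1-3)] orbit_backtrack[OF assms(1) assms(3,2)]
    by (cases "a \<le> b") auto
qed

lemma orbit_initial_point:
  assumes "successively (\<lambda>u v. u \<in> A \<and> v = s u) l" "p \<in> set l" "p \<notin> s ` A"
  shows "p = hd l"
  using ex_predecessor[OF assms(2)] consecutive_successively[OF _ assms(1)] assms(3) by blast

lemma strict_mono_on_self_map_id: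
  fixes \<tau> :: "nat \<Rightarrow> nat"
  assumes "\<And>i. i \<in> {1..n} \<Longrightarrow> \<tau> i \<in> {1..n}"
    and "\<And>i j. i \<in> {1..n} \<Longrightarrow> j \<in> {1..n} \<Longrightarrow> i < j \<Longrightarrow> \<tau> i < \<tau> j"
    and "i \<in> {1..n}"
  shows "\<tau> i = i"
proof (rule antisym)
  have "Suc k \<in> {1..n} \<Longrightarrow> Suc k \<le> \<tau> (Suc k)" for k
  proof (induction k)
    case 0
    then show ?case using assms(1)[of 1] by simp
  next
    case (Suc k)
    then show ?case using assms(2)[of "Suc k" "Suc (Suc k)"] by fastforce
  qed
  from this[of "i - 1"] show "i \<le> \<tau> i" using assms(3) by simp
  have "k < n \<Longrightarrow> \<tau> (n - k) \<le> n - k" for k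
  proof (induction k)
    case 0
    then show ?case using assms(1)[of n] by simp
  next
    case (Suc k)
    then have "\<tau> (n - Suc k) < \<tau> (n - k)" by (intro assms(2)) auto
    with Suc show ?case by simp
  qed
  from this[of "n - i"] show "\<tau> i \<le> i" using assms(3) by simp
qed

section \<open>From tuples of paths to matchings\<close>

definition start_point :: "nat \<Rightarrow> int \<times> int" where "start_point i = (- 2 * int i + 1, 0)"
definition end_point :: "nat \<Rightarrow> int \<times> int" where "end_point i = (2 * int i - 1, 0)"

text \<open>The points that paths of a tuple can visit; besides sources and targets it contains the
  triangle \<open>x + y \<le> -3\<close> left of the diamond and the triangle \<open>y - x \<le> -3\<close> right of it.\<close>

definition path_region :: "nat \<Rightarrow> (int \<times> int) set" where
  "path_region n = {(x, y). odd (x + y) \<and> 0 \<le> y \<and> x + y \<le> 2 * int n - 1 \<and> y - x \<le> 2 * int n - 1}"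

text \<open>Outside the diamond the only possible continuation of a path is upwards in the left
  triangle and downwards in the right one.\<close>

definition extend_matching :: "nat \<Rightarrow> (int \<times> int \<Rightarrow> int \<times> int) \<Rightarrow> int \<times> int \<Rightarrow> int \<times> int" where
  "extend_matching n \<sigma> p =
     (if p \<in> sources n then \<sigma> p else if fst p < 0 then p + (1, 1) else p + (1, -1))"

definition matching_of_paths :: "nat \<Rightarrow> (nat \<Rightarrow> (int \<times> int) list) \<Rightarrow> int \<times> int \<Rightarrow> int \<times> int" where
  "matching_of_paths n \<pi> = restrict (\<lambda>p.
     if \<exists>v. \<exists>i\<in>{1..n}. consecutive (\<pi> i) p v then SOME v. \<exists>i\<in>{1..n}. consecutive (\<pi> i) p v else p)
     (sources n)"

text \<open>The gaps between the three cases contain no points of odd \<open>x + y\<close>.\<close>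

lemma path_region_cases:
  assumes "p \<in> path_region n"
  obtains "p \<in> sources n"
    | "p \<notin> sources n" "fst p < 0" "fst p + snd p \<le> - 3"
    | "p \<notin> sources n" "fst p > 0" "snd p - fst p \<le> - 1" "fst p + snd p \<ge> 1"
proof -
  obtain x y where p: "p = (x, y)" by (cases p)
  have r: "odd (x + y)" "0 \<le> y" "x + y \<le> 2 * int n - 1" "y - x \<le> 2 * int n - 1"
    using assms p by (auto simp: path_region_def)
  have "x + y \<noteq> - 2" "y - x \<noteq> 0" "x + y \<noteq> 0" using r(1) by presburger+
  then show thesis
    using that r p by (cases "x + y < -1"; cases "y - x < 1") (auto simp: sources_def)
qed

locale path_tuple =
  fixes n :: nat and \<pi> :: "nat \<Rightarrow> (int \<times> int) list"
  assumes tuple: "\<pi> \<in> nonintersecting_path_tuples n"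
begin

lemma
  assumes "i \<in> {1..n}"
  shows path_nonempty: "\<pi> i \<noteq> []"
    and path_steps: "successively is_step (\<pi> i)"
    and path_above: "(x, y) \<in> set (\<pi> i) \<Longrightarrow> 0 \<le> y"
    and path_hd: "hd (\<pi> i) = start_point i"
    and path_last: "last (\<pi> i) = end_point i"
proof -
  have "large_schroeder_path (\<pi> i)" "path_from_to (\<pi> i) (- 2 * int i + 1, 0) (2 * int i - 1, 0)"
    using tuple assms unfolding nonintersecting_path_tuples_def by auto
  then show "\<pi> i \<noteq> []" "successively is_step (\<pi> i)" "(x, y) \<in> set (\<pi> i) \<Longrightarrow> 0 \<le> y"
    "hd (\<pi> i) = start_point i" "last (\<pi> i) = end_point i"
    unfolding large_schroeder_path_def path_from_to_def is_step_def start_point_def end_point_def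
    by auto
qed

lemma path_index_unique:
  assumes "i \<in> {1..n}" "j \<in> {1..n}" "p \<in> set (\<pi> i)" "p \<in> set (\<pi> j)"
  shows "i = j"
proof (rule ccontr)
  assume "i \<noteq> j"
  moreover have "\<forall>i\<in>{1..n}. \<forall>j\<in>{1..n}. i \<noteq> j \<longrightarrow> \<not> paths_intersect (\<pi> i) (\<pi> j)"
    using tuple unfolding nonintersecting_path_tuples_def mem_Collect_eq by (elim conjE)
  ultimately have "\<not> paths_intersect (\<pi> i) (\<pi> j)" using assms(1,2) by blast
  with assms(3,4) show False unfolding paths_intersect_def by blast
qed

lemma consecutive_index_unique:
  assumes "i \<in> {1..n}" "j \<in> {1..n}" "consecutive (\<pi> i) u v" "u \<in> set (\<pi> j) \<or> v \<in> set (\<pi> j)"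
  shows "i = j"
  using assms path_index_unique[OF assms(1,2)] consecutive_mem[OF assms(3)] by blast

lemma start_in_path: "i \<in> {1..n} \<Longrightarrow> start_point i \<in> set (\<pi> i)"
  using path_hd path_nonempty hd_in_set by metis

lemma end_in_path: "i \<in> {1..n} \<Longrightarrow> end_point i \<in> set (\<pi> i)"
  using path_last path_nonempty last_in_set by metis

lemma path_bounds:
  assumes i: "i \<in> {1..n}" and p: "(x, y) \<in> set (\<pi> i)"
  shows "odd (x + y)" "0 \<le> y" "x + y \<le> 2 * int i - 1" "y - x \<le> 2 * int i - 1"
proof -
  \<comment> \<open>Every point of a path lies to the right of its start and to the left of its end in the cone order.\<close>
  have "(x, y) = start_point i \<or> in_right_cone (start_point i) (x, y)"
    using hd_in_right_cone[OF path_steps[OF i] p] path_hd[OF i] by auto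
  then show "odd (x + y)" "y - x \<le> 2 * int i - 1"
    by (auto simp: start_point_def in_right_cone_def)
  have "(x, y) = end_point i \<or> in_right_cone (x, y) (end_point i)"
    using in_right_cone_last[OF path_steps[OF i] p] path_last[OF i] by auto
  then show "x + y \<le> 2 * int i - 1"
    by (auto simp: end_point_def in_right_cone_def)
  show "0 \<le> y" using path_above[OF i p] .
qed

lemma path_in_region: "i \<in> {1..n} \<Longrightarrow> p \<in> set (\<pi> i) \<Longrightarrow> p \<in> path_region n"
  using path_bounds[of i "fst p" "snd p"] by (cases p) (auto simp: path_region_def)

text \<open>Induction on the height \<open>k\<close>, for all paths at once. If the \<open>i\<close>-th path did not go up from
  height \<open>k\<close>, it would step on a point at height \<open>k\<close> or \<open>k - 1\<close> that is already known to belong to the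
  initial segment of the neighbouring path \<open>i - 1\<close>, or go below the axis.\<close>

lemma initial_up_steps:
  "k < i \<Longrightarrow> i \<le> n \<Longrightarrow> a = - 2 * int i + 1 + int k \<Longrightarrow> b = int k \<Longrightarrow> (a, b) \<in> set (\<pi> i)"
proof (induction k arbitrary: i a b rule: less_induct)
  case (less k)
  show ?case
  proof (cases k)
    case 0
    then show ?thesis using start_in_path[of i] less.prems by (simp add: start_point_def)
  next
    case (Suc m)
    let ?u = "(- 2 * int i + 1 + int m, int m)"
    have i: "i \<in> {1..n}" "i - 1 \<in> {1..n}" "i - 1 \<noteq> i" and int_i: "int (i - 1) = int i - 1"
      using less.prems Suc by auto
    have u: "?u \<in> set (\<pi> i)" using less.IH[of m i] less.prems(1,2) Suc by simp
    have ne: "?u \<noteq> last (\<pi> i)"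
      using path_last[OF i(1)] less.prems Suc by (simp add: end_point_def)
    obtain v where v: "consecutive (\<pi> i) ?u v" using ex_successor[OF u ne] by (rule exE)
    obtain x y where xy: "v = (x, y)" by (cases v)
    have vi: "(x, y) \<in> set (\<pi> i)" using consecutive_mem[OF v] xy by blast
    have not: "(x, y) \<notin> set (\<pi> (i - 1))" using path_index_unique[OF i(1,2) vi] i(3) by auto
    have "is_step ?u (x, y)"
      using consecutive_successively[OF v path_steps[OF i(1)]] xy by simp
    then have "x = - 2 * int i + 2 + int m \<and> y = int m + 1 \<or>
        x = - 2 * int i + 2 + int m \<and> y = int m - 1 \<or> x = - 2 * int i + 3 + int m \<and> y = int m"
      unfolding is_step_iff by linarith
    then consider "x = - 2 * int i + 2 + int m" "y = int m + 1"
      | "x = - 2 * int i + 2 + int m" "y = int m - 1" | "x = - 2 * int i + 3 + int m" "y = int m"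
      by blast
    then show ?thesis
    proof cases
      case 1
      then have "(x, y) = (a, b)" using Suc less.prems by simp
      then show ?thesis using vi by simp
    next
      case 2
      show ?thesis
      proof (cases m)
        case 0
        then show ?thesis using 2 path_above[OF i(1) vi] by simp
      next
        case (Suc l)
        then have "int m = int l + 1" "l < k" "l < i - 1" "i - 1 \<le> n"
          using less.prems \<open>k = Suc m\<close> by auto
        with 2 int_i have "(x, y) \<in> set (\<pi> (i - 1))" by (intro less.IH[of l]) auto
        then show ?thesis using not by simp
      qed
    next
      case 3
      then have "(x, y) \<in> set (\<pi> (i - 1))"
        using less.prems Suc int_i by (intro less.IH[of m]) linarith+
      then show ?thesis using not by simp
    qed
  qed
qed

text \<open>The mirror image of the preceding lemma, with predecessors in place of successors.\<close>

lemma final_down_steps: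
  "k < i \<Longrightarrow> i \<le> n \<Longrightarrow> a = 2 * int i - 1 - int k \<Longrightarrow> b = int k \<Longrightarrow> (a, b) \<in> set (\<pi> i)"
proof (induction k arbitrary: i a b rule: less_induct)
  case (less k)
  show ?case
  proof (cases k)
    case 0
    then show ?thesis using end_in_path[of i] less.prems by (simp add: end_point_def)
  next
    case (Suc m)
    let ?u = "(2 * int i - 1 - int m, int m)"
    have i: "i \<in> {1..n}" "i - 1 \<in> {1..n}" "i - 1 \<noteq> i" and int_i: "int (i - 1) = int i - 1"
      using less.prems Suc by auto
    have u: "?u \<in> set (\<pi> i)" using less.IH[of m i] less.prems(1,2) Suc by simp
    have ne: "?u \<noteq> hd (\<pi> i)"
      using path_hd[OF i(1)] less.prems Suc by (simp add: start_point_def)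
    obtain v where v: "consecutive (\<pi> i) v ?u" using ex_predecessor[OF u ne] by (rule exE)
    obtain x y where xy: "v = (x, y)" by (cases v)
    have vi: "(x, y) \<in> set (\<pi> i)" using consecutive_mem[OF v] xy by blast
    have not: "(x, y) \<notin> set (\<pi> (i - 1))" using path_index_unique[OF i(1,2) vi] i(3) by auto
    have "is_step (x, y) ?u"
      using consecutive_successively[OF v path_steps[OF i(1)]] xy by simp
    then have "x = 2 * int i - 2 - int m \<and> y = int m + 1 \<or>
        x = 2 * int i - 2 - int m \<and> y = int m - 1 \<or> x = 2 * int i - 3 - int m \<and> y = int m"
      unfolding is_step_iff by linarith
    then consider "x = 2 * int i - 2 - int m" "y = int m + 1"
      | "x = 2 * int i - 2 - int m" "y = int m - 1" | "x = 2 * int i - 3 - int m" "y = int m"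
      by blast
    then show ?thesis
    proof cases
      case 1
      then have "(x, y) = (a, b)" using Suc less.prems by simp
      then show ?thesis using vi by simp
    next
      case 2
      show ?thesis
      proof (cases m)
        case 0
        then show ?thesis using 2 path_above[OF i(1) vi] by simp
      next
        case (Suc l)
        then have "int m = int l + 1" "l < k" "l < i - 1" "i - 1 \<le> n"
          using less.prems \<open>k = Suc m\<close> by auto
        with 2 int_i have "(x, y) \<in> set (\<pi> (i - 1))" by (intro less.IH[of l]) auto
        then show ?thesis using not by simp
      qed
    next
      case 3
      then have "(x, y) \<in> set (\<pi> (i - 1))"
        using less.prems Suc int_i by (intro less.IH[of m]) linarith+
      then show ?thesis using not by simp
    qed
  qed
qed

lemma consecutive_left_triangle:
  assumes i: "i \<in> {1..n}" and uv: "consecutive (\<pi> i) (x, y) v" and left: "x + y \<le> - 3"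
  shows "v = (x + 1, y + 1)"
proof -
  have u: "(x, y) \<in> set (\<pi> i)" using consecutive_mem[OF uv] by blast
  note b = path_bounds[OF i u]
  have "even (y - x + 1)" using b(1) by simp
  then obtain m where m: "y - x + 1 = 2 * m" by (elim evenE)
  \<comment> \<open>The index \<open>j\<close> is that of the path whose initial diagonal contains \<open>(x, y)\<close>.\<close>
  define j where "j = nat m"
  define k where "k = nat y"
  have jk: "int j = m" "int k = y" "j \<in> {1..n}" "Suc k < j"
    using m b left i unfolding j_def k_def by auto
  have "(x, y) \<in> set (\<pi> j)"
    using jk m by (auto intro!: initial_up_steps[of k j])
  moreover have "(x + 1, y + 1) \<in> set (\<pi> j)"
    using jk m by (auto intro!: initial_up_steps[of "Suc k" j])
  moreover have "j = i" using path_index_unique[OF jk(3) i _ u] calculation(1) by blast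
  ultimately show ?thesis
    using consecutive_next_column[OF path_steps[OF i] uv, of "(x + 1, y + 1)"] by simp
qed

lemma consecutive_right_triangle:
  assumes i: "i \<in> {1..n}" and uv: "consecutive (\<pi> i) (x, y) v" and right: "y - x \<le> - 1"
  shows "v = (x + 1, y - 1)"
proof -
  have u: "(x, y) \<in> set (\<pi> i)" using consecutive_mem[OF uv] by blast
  note b = path_bounds[OF i u]
  have "even (x + y + 1)" using b(1) by simp
  then obtain m where m: "x + y + 1 = 2 * m" by (elim evenE)
  \<comment> \<open>The index \<open>j\<close> is that of the path whose final diagonal contains \<open>(x, y)\<close>.\<close>
  define j where "j = nat m"
  define k where "k = nat y"
  have jk: "int j = m" "int k = y" "j \<in> {1..n}" "k < j"
    using m b right i unfolding j_def k_def by auto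
  have uj: "(x, y) \<in> set (\<pi> j)"
    using jk m by (auto intro!: final_down_steps[of k j])
  have ji: "j = i" using path_index_unique[OF jk(3) i uj u] .
  \<comment> \<open>On the axis the point would be the end of the path, which has no successor.\<close>
  have "k \<noteq> 0"
  proof
    assume "k = 0"
    then have u: "(x, y) = last (\<pi> i)" using path_last[OF i] jk m ji by (simp add: end_point_def)
    have "fst (x, y) < fst v"
      using consecutive_successively[OF uv path_steps[OF i]] by (cases v) (auto simp: is_step_iff)
    moreover have "v = last (\<pi> i) \<or> in_right_cone v (last (\<pi> i))"
      using in_right_cone_last[OF path_steps[OF i]] consecutive_mem[OF uv] by blast
    ultimately show False unfolding u[symmetric] by (auto simp: in_right_cone_def)
  qed
  then have "(x + 1, y - 1) \<in> set (\<pi> j)"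
    using jk m by (auto intro!: final_down_steps[of "k - 1" j])
  with ji show ?thesis
    using consecutive_next_column[OF path_steps[OF i] uv, of "(x + 1, y - 1)"] by simp
qed

text \<open>The choice in the definition is unambiguous: a point lies on at most one path, and at most
  once.\<close>

lemma matching_of_paths_consecutive:
  assumes "i \<in> {1..n}" "consecutive (\<pi> i) p v" "p \<in> sources n"
  shows "matching_of_paths n \<pi> p = v"
proof -
  have uniq: "w = v" if "j \<in> {1..n}" "consecutive (\<pi> j) p w" for j w
  proof -
    have "i = j" using consecutive_index_unique[OF assms(1) that(1) assms(2)] consecutive_mem[OF that(2)] by blast
    then show ?thesis using consecutive_unique(1)[OF path_steps[OF assms(1)] assms(2)] that(2) by blast
  qed
  have "(SOME w. \<exists>i\<in>{1..n}. consecutive (\<pi> i) p w) = v"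
    using assms uniq by (intro some_equality) blast+
  moreover have "\<exists>w. \<exists>i\<in>{1..n}. consecutive (\<pi> i) p w" using assms(1,2) by blast
  ultimately show ?thesis using assms(3) unfolding matching_of_paths_def by simp
qed

lemma matching_of_paths_fixed:
  assumes "p \<in> sources n" "\<And>i v. i \<in> {1..n} \<Longrightarrow> \<not> consecutive (\<pi> i) p v"
  shows "matching_of_paths n \<pi> p = p"
  using assms by (auto simp: matching_of_paths_def)

text \<open>This is what makes a tuple recoverable from its matching: all its paths, including their
  parts outside the diamond, are orbits of one map.\<close>

lemma consecutive_extend_matching:
  assumes i: "i \<in> {1..n}" and uv: "consecutive (\<pi> i) u v"
  shows "v = extend_matching n (matching_of_paths n \<pi>) u"
proof -
  have "u \<in> path_region n" using path_in_region[OF i] consecutive_mem[OF uv] by blast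
  then show ?thesis
  proof (cases rule: path_region_cases)
    case 1
    then show ?thesis
      using matching_of_paths_consecutive[OF i uv] by (simp add: extend_matching_def)
  next
    case 2
    then show ?thesis using consecutive_left_triangle[OF i, of "fst u" "snd u" v] uv
      by (cases u) (simp add: extend_matching_def)
  next
    case 3
    then show ?thesis using consecutive_right_triangle[OF i, of "fst u" "snd u" v] uv
      by (cases u) (simp add: extend_matching_def)
  qed
qed

text \<open>The left boundary points of the diamond are exactly where the forced initial segments end,
  one on each path.\<close>

lemma source_on_path:
  assumes "(x, y) \<in> path_region n" "x + y = - 1"
  shows "nat y + 1 \<in> {1..n}" "(x, y) \<in> set (\<pi> (nat y + 1))"
proof -
  show i: "nat y + 1 \<in> {1..n}" using assms by (auto simp: path_region_def)
  show "(x, y) \<in> set (\<pi> (nat y + 1))"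
    using assms i by (auto simp: path_region_def intro!: initial_up_steps[of "nat y"])
qed

lemma target_on_path:
  assumes "(x, y) \<in> path_region n" "y - x = - 1"
  shows "nat y + 1 \<in> {1..n}" "(x, y) \<in> set (\<pi> (nat y + 1))"
proof -
  show i: "nat y + 1 \<in> {1..n}" using assms by (auto simp: path_region_def)
  show "(x, y) \<in> set (\<pi> (nat y + 1))"
    using assms i by (auto simp: path_region_def intro!: final_down_steps[of "nat y"])
qed

end

section \<open>Tuples of paths inject into matchings\<close>

lemma sources_subset_region: "sources n \<subseteq> path_region n"
  by (auto simp: sources_def path_region_def)

lemma targets_subset_region: "targets n \<subseteq> path_region n"
  by (auto simp: targets_def path_region_def)

lemma targets_cases:
  assumes "(x, y) \<in> targets n"
  obtains "(x, y) \<in> sources n" | "y - x = - 1"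
proof (cases "y - x = - 1")
  case False
  have "odd (y - x)" using assms by (simp add: targets_def)
  then have "y - x \<noteq> 0" by (metis even_zero)
  with False assms have "(x, y) \<in> sources n" by (auto simp: sources_def targets_def)
  then show thesis using that by blast
qed (use that in blast)

lemma sources_cases:
  assumes "(x, y) \<in> sources n"
  obtains "(x, y) \<in> targets n" | "x + y = - 1"
proof (cases "x + y = - 1")
  case False
  have "odd (x + y)" using assms by (simp add: sources_def)
  then have "x + y \<noteq> 0" by (metis even_zero)
  with False assms have "(x, y) \<in> targets n" by (auto simp: sources_def targets_def)
  then show thesis using that by blast
qed (use that in blast)

lemma is_step_domino_step: "is_step u v \<Longrightarrow> v - u \<in> domino_steps"
  by (auto simp: is_step_def domino_steps_def)

lemma domino_step_cases: "v - u \<in> domino_steps \<Longrightarrow> v = u \<or> is_step u v"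
  by (cases u; cases v) (auto simp: is_step_def domino_steps_def)

context path_tuple
begin

lemma source_successor:
  assumes "i \<in> {1..n}" "p \<in> set (\<pi> i)" "p \<in> sources n"
  shows "\<exists>v. consecutive (\<pi> i) p v"
proof (rule ex_successor[OF assms(2)])
  show "p \<noteq> last (\<pi> i)" using assms(1,3) path_last[OF assms(1)]
    by (auto simp: end_point_def sources_def)
qed

lemma target_predecessor:
  assumes "i \<in> {1..n}" "q \<in> set (\<pi> i)" "q \<in> targets n"
  shows "\<exists>p\<in>sources n. consecutive (\<pi> i) p q"
proof -
  have "q \<noteq> hd (\<pi> i)" using assms(1,3) path_hd[OF assms(1)]
    by (auto simp: start_point_def targets_def)
  then obtain p where p: "consecutive (\<pi> i) p q" using ex_predecessor[OF assms(2)] by blast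
  obtain x y where xy: "p = (x, y)" by (cases p)
  have "p \<in> path_region n" using path_in_region[OF assms(1)] consecutive_mem[OF p] by blast
  then have "p \<in> sources n"
  proof (cases rule: path_region_cases)
    case 2
    then have "q = (x + 1, y + 1)" using consecutive_left_triangle[OF assms(1), of x y q] p xy by simp
    with 2 xy assms(3) show ?thesis by (simp add: targets_def)
  next
    case 3
    then have "q = (x + 1, y - 1)" using consecutive_right_triangle[OF assms(1), of x y q] p xy by simp
    with 3 xy assms(3) show ?thesis by (simp add: targets_def)
  qed
  with p show ?thesis by blast
qed

text \<open>A step inside the diamond could miss \<open>targets\<close> only by going down along the left
  boundary. But consecutive left boundary points belong to different paths.\<close>

lemma consecutive_source_target:
  assumes i: "i \<in> {1..n}" and c: "consecutive (\<pi> i) p v" and p: "p \<in> sources n"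
  shows "v \<in> targets n"
proof -
  obtain x y x' y' where xy: "p = (x, y)" "v = (x', y')" by (cases p; cases v)
  have st: "is_step (x, y) (x', y')" using consecutive_successively[OF c path_steps[OF i]] xy by simp
  have mem: "(x, y) \<in> set (\<pi> i)" "(x', y') \<in> set (\<pi> i)" using consecutive_mem[OF c] xy by auto
  have reg: "(x, y) \<in> path_region n" "(x', y') \<in> path_region n" using path_in_region[OF i] mem by blast+
  have s: "- 1 \<le> x + y" "1 \<le> y - x" "odd (x + y)" using p xy by (auto simp: sources_def)
  have b: "- 1 \<le> x' + y'" "- 1 \<le> y' - x'"
    using st s unfolding is_step_iff by auto
  have "x' + y' \<noteq> - 1"
  proof
    assume v: "x' + y' = - 1"
    then have d: "y' = y - 1" "x + y = - 1" using st s unfolding is_step_iff by auto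
    have "nat y + 1 = i" using path_index_unique[OF source_on_path(1)[OF reg(1) d(2)] i source_on_path(2)[OF reg(1) d(2)] mem(1)] .
    moreover have "nat y' + 1 = i" using path_index_unique[OF source_on_path(1)[OF reg(2) v] i source_on_path(2)[OF reg(2) v] mem(2)] .
    moreover have "0 \<le> y'" using reg(2) by (auto simp: path_region_def)
    ultimately show False using d(1) by simp
  qed
  moreover have "odd (x' + y')" using reg(2) by (simp add: path_region_def)
  then have "x' + y' \<noteq> 0" by (metis even_zero)
  ultimately have "1 \<le> x' + y'" using b(1) by linarith
  then show ?thesis using reg(2) b(2) xy by (auto simp: targets_def path_region_def)
qed

lemma matching_of_paths_cases:
  assumes "p \<in> sources n"
  obtains i where "i \<in> {1..n}" "consecutive (\<pi> i) p (matching_of_paths n \<pi> p)"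
    | "\<And>i. i \<in> {1..n} \<Longrightarrow> p \<notin> set (\<pi> i)" "matching_of_paths n \<pi> p = p"
proof (cases "\<exists>i\<in>{1..n}. p \<in> set (\<pi> i)")
  case True
  then obtain i where i: "i \<in> {1..n}" "p \<in> set (\<pi> i)" by blast
  then obtain v where "consecutive (\<pi> i) p v" using source_successor assms by blast
  then show ?thesis using that(1)[OF i(1)] matching_of_paths_consecutive[OF i(1)] assms by simp
next
  case False
  have "matching_of_paths n \<pi> p = p"
  proof (rule matching_of_paths_fixed[OF assms])
    show "\<not> consecutive (\<pi> i) p v" if "i \<in> {1..n}" for i v
      using consecutive_mem[of "\<pi> i" p v] False that by auto
  qed
  then show ?thesis using that(2) False by blast
qed

text \<open>A point off the paths is fixed, hence must be both a source and a target; this holds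
  because the points that are only one of the two lie on the left or right boundary, and all of these
  are on paths.\<close>

lemma matching_of_paths_step_matching: "matching_of_paths n \<pi> \<in> step_matchings n"
proof -
  let ?\<sigma> = "matching_of_paths n \<pi>"
  have tgt: "?\<sigma> p \<in> targets n \<and> ?\<sigma> p - p \<in> domino_steps" if p: "p \<in> sources n" for p
    using p
  proof (cases rule: matching_of_paths_cases)
    case (1 i)
    then show ?thesis
      using consecutive_source_target[OF 1 p] consecutive_successively[OF 1(2) path_steps[OF 1(1)]]
        is_step_domino_step by blast
  next
    case 2
    obtain x y where xy: "p = (x, y)" by (cases p)
    have "p \<in> targets n" using p unfolding xy
    proof (cases rule: sources_cases)
      case a: 2
      have "(x, y) \<in> path_region n" using p sources_subset_region xy by blast
      from source_on_path[OF this a] have False using 2(1) xy by blast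
      then show "(x, y) \<in> targets n" ..
    qed
    then show ?thesis using 2(2) by (simp add: domino_steps_def zero_prod_def)
  qed
  have "inj_on ?\<sigma> (sources n)"
  proof (rule inj_onI)
    fix p q assume p: "p \<in> sources n" and q: "q \<in> sources n" and eq: "?\<sigma> p = ?\<sigma> q"
    show "p = q"
      using p
    proof (cases rule: matching_of_paths_cases)
      case i: (1 i)
      have vi: "?\<sigma> p \<in> set (\<pi> i)" using consecutive_mem[OF i(2)] by blast
      show ?thesis
        using q
      proof (cases rule: matching_of_paths_cases)
        case j: (1 j)
        have "?\<sigma> p \<in> set (\<pi> j)" using consecutive_mem[OF j(2)] eq by simp
        then have "i = j" using path_index_unique[OF i(1) j(1) vi] by blast
        then show ?thesis using consecutive_unique(2)[OF path_steps[OF i(1)] i(2)] j(2) eq by simp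
      next
        case 2
        then show ?thesis using vi i(1) eq by simp
      qed
    next
      case p2: 2
      show ?thesis
        using q
      proof (cases rule: matching_of_paths_cases)
        case j: (1 j)
        then have "p \<in> set (\<pi> j)" using consecutive_mem[OF j(2)] eq p2(2) by simp
        then show ?thesis using p2(1)[OF j(1)] by simp
      next
        case 2
        then show ?thesis using eq p2(2) by simp
      qed
    qed
  qed
  moreover have "targets n \<subseteq> ?\<sigma> ` sources n"
  proof
    fix q assume q: "q \<in> targets n"
    show "q \<in> ?\<sigma> ` sources n"
    proof (cases "\<exists>i\<in>{1..n}. q \<in> set (\<pi> i)")
      case True
      then obtain i where i: "i \<in> {1..n}" "q \<in> set (\<pi> i)" by blast
      then obtain p where p: "p \<in> sources n" "consecutive (\<pi> i) p q"
        using target_predecessor q by blast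
      then have "?\<sigma> p = q" using matching_of_paths_consecutive[OF i(1)] by blast
      then show ?thesis using p(1) by blast
    next
      case False
      obtain x y where xy: "q = (x, y)" by (cases q)
      have "q \<in> sources n" using q unfolding xy
      proof (cases rule: targets_cases)
        case 2
        have "(x, y) \<in> path_region n" using q targets_subset_region xy by blast
        from target_on_path[OF this 2] have False using False xy by blast
        then show "(x, y) \<in> sources n" ..
      qed
      moreover from this have "?\<sigma> q = q"
      proof (cases rule: matching_of_paths_cases)
        case (1 i)
        from consecutive_mem[OF 1(2)] False 1(1) show ?thesis by simp
      qed
      ultimately show ?thesis by (metis imageI)
    qed
  qed
  moreover have "?\<sigma> ` sources n \<subseteq> targets n" using tgt by blast
  ultimately have "bij_betw ?\<sigma> (sources n) (targets n)"
    by (auto simp: bij_betw_def)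
  moreover have "?\<sigma> \<in> extensional (sources n)" by (simp add: matching_of_paths_def)
  ultimately show ?thesis using tgt by (simp add: step_matchings_def PiE_def)
qed

end

lemma inj_on_matching_of_paths: "inj_on (matching_of_paths n) (nonintersecting_path_tuples n)"
proof (rule inj_onI)
  fix \<pi> \<rho> assume \<pi>: "\<pi> \<in> nonintersecting_path_tuples n" and \<rho>: "\<rho> \<in> nonintersecting_path_tuples n"
    and eq: "matching_of_paths n \<pi> = matching_of_paths n \<rho>"
  interpret p: path_tuple n \<pi> by standard (rule \<pi>)
  interpret r: path_tuple n \<rho> by standard (rule \<rho>)
  let ?s = "extend_matching n (matching_of_paths n \<pi>)"
  have mono: "fst u < fst v" if "is_step u v" for u v
    using is_step_in_right_cone[OF that] by (simp add: in_right_cone_def)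
  show "\<pi> = \<rho>"
  proof (rule PiE_ext)
    show "\<pi> \<in> {1..n} \<rightarrow>\<^sub>E {p. large_schroeder_path p}"
      using \<pi> by (simp add: nonintersecting_path_tuples_def)
    show "\<rho> \<in> {1..n} \<rightarrow>\<^sub>E {p. large_schroeder_path p}"
      using \<rho> by (simp add: nonintersecting_path_tuples_def)
    fix i assume i: "i \<in> {1..n}"
    show "\<pi> i = \<rho> i"
    proof (rule iterated_list_unique[of ?s fst])
      show "successively (\<lambda>u v. v = ?s u \<and> fst u < fst v) (\<pi> i)"
      proof (rule successively_consecutiveI)
        fix u v assume c: "consecutive (\<pi> i) u v"
        show "v = ?s u \<and> fst u < fst v"
          using p.consecutive_extend_matching[OF i c]
            mono[OF consecutive_successively[OF c p.path_steps[OF i]]] by (rule conjI)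
      qed
      show "successively (\<lambda>u v. v = ?s u \<and> fst u < fst v) (\<rho> i)"
      proof (rule successively_consecutiveI)
        fix u v assume c: "consecutive (\<rho> i) u v"
        show "v = ?s u \<and> fst u < fst v"
          using r.consecutive_extend_matching[OF i c, folded eq]
            mono[OF consecutive_successively[OF c r.path_steps[OF i]]] by (rule conjI)
      qed
    qed (use p.path_nonempty[OF i] r.path_nonempty[OF i] p.path_hd[OF i] r.path_hd[OF i]
           p.path_last[OF i] r.path_last[OF i] in simp_all)
  qed
qed

section \<open>From matchings to tuples of paths\<close>

definition path_ends :: "nat \<Rightarrow> (int \<times> int) set" where
  "path_ends n = end_point ` {1..n}"

text \<open>A path that descends in the right triangle reaches the axis at one of the prescribed end
  points, since those are all the odd points there.\<close>

lemma region_axis: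
  assumes "(x, 0) \<in> path_region n" "0 < x"
  shows "(x, 0) \<in> path_ends n"
proof -
  have "odd x" "x \<le> 2 * int n - 1" using assms by (auto simp: path_region_def)
  then obtain m where m: "x = 2 * m + 1" by (elim oddE)
  with assms(2) \<open>x \<le> 2 * int n - 1\<close> have "nat (m + 1) \<in> {1..n}" "(x, 0) = end_point (nat (m + 1))"
    by (auto simp: end_point_def)
  then show ?thesis unfolding path_ends_def by blast
qed

locale step_matching =
  fixes n :: nat and \<sigma> :: "int \<times> int \<Rightarrow> int \<times> int"
  assumes matching: "\<sigma> \<in> step_matchings n"
begin

abbreviation next_point :: "int \<times> int \<Rightarrow> int \<times> int" where
  "next_point \<equiv> extend_matching n \<sigma>"

abbreviation inner_points :: "(int \<times> int) set" where
  "inner_points \<equiv> path_region n - path_ends n"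

lemma next_point_cases:
  assumes "p \<in> inner_points"
  obtains "p \<in> sources n" "next_point p = \<sigma> p" "next_point p \<in> targets n"
    | x y where "p = (x, y)" "next_point p = (x + 1, y + 1)" "x + y \<le> - 3" "0 \<le> y"
    | x y where "p = (x, y)" "next_point p = (x + 1, y - 1)" "y - x \<le> - 1" "1 \<le> y"
proof -
  have "p \<in> path_region n" using assms by blast
  then show thesis
  proof (cases rule: path_region_cases)
    case 1
    then show ?thesis using that(1) step_matchingsD(4)[OF matching] by (simp add: extend_matching_def)
  next
    case 2
    then show ?thesis using that(2)[of "fst p" "snd p"] assms
      by (cases p) (auto simp: extend_matching_def path_region_def)
  next
    case 3
    obtain x y where xy: "p = (x, y)" by (cases p)
    have "y \<noteq> 0" using region_axis[of x n] 3 assms xy by auto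
    moreover have "0 \<le> y" using assms xy by (auto simp: path_region_def)
    ultimately show ?thesis using that(3)[of x y] 3 xy by (auto simp: extend_matching_def)
  qed
qed

lemma next_point_in_region:
  assumes "p \<in> inner_points"
  shows "next_point p \<in> path_region n"
  using assms
proof (cases rule: next_point_cases)
  case 1
  then show ?thesis using targets_subset_region by blast
qed (use assms in \<open>auto simp: path_region_def\<close>)

lemma next_point_step:
  assumes "p \<in> inner_points"
  shows "next_point p = p \<or> is_step p (next_point p)"
  using assms
proof (cases rule: next_point_cases)
  case 1
  then show ?thesis using step_matchingsD(3)[OF matching] domino_step_cases by metis
qed (simp_all add: is_step_iff)

lemma inj_on_next_point: "inj_on next_point inner_points"
proof (rule inj_onI)
  fix p q assume p: "p \<in> inner_points" and q: "q \<in> inner_points" and eq: "next_point p = next_point q"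
  have inj: "inj_on \<sigma> (sources n)"
    using bij_betw_imp_inj_on[OF step_matchingsD(2)[OF matching]] .
  have source_eq: "p' = q'"
    if p': "p' \<in> sources n" "next_point p' = \<sigma> p'" "next_point p' \<in> targets n"
      and q': "q' \<in> inner_points" "next_point p' = next_point q'" for p' q'
    using q'(1)
  proof (cases rule: next_point_cases)
    case 1
    then have "\<sigma> p' = \<sigma> q'" using p'(2) q'(2) by simp
    then show ?thesis using inj p'(1) 1(1) by (simp add: inj_on_eq_iff)
  next
    case (2 x y)
    then have "(x + 1, y + 1) \<in> targets n" using p'(3) q'(2) by simp
    with 2(3) show ?thesis by (simp add: targets_def)
  next
    case (3 x y)
    then have "(x + 1, y - 1) \<in> targets n" using p'(3) q'(2) by simp
    with 3(3) show ?thesis by (simp add: targets_def)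
  qed
  from p show "p = q"
  proof (cases rule: next_point_cases)
    case 1
    then show ?thesis using source_eq q eq by blast
  next
    case a: (2 x y)
    from q show ?thesis
    proof (cases rule: next_point_cases)
      case 1
      then show ?thesis using source_eq[of q p] p eq by simp
    next
      case (2 x' y')
      then show ?thesis using a eq by simp
    next
      case (3 x' y')
      then have "x = x'" "y + 1 = y' - 1" using a(2) eq by auto
      then show ?thesis using a(3,4) 3(3,4) by simp
    qed
  next
    case a: (3 x y)
    from q show ?thesis
    proof (cases rule: next_point_cases)
      case 1
      then show ?thesis using source_eq[of q p] p eq by simp
    next
      case (2 x' y')
      then have "x = x'" "y - 1 = y' + 1" using a(2) eq by auto
      then show ?thesis using a(3,4) 2(3,4) by simp
    next
      case (3 x' y')
      then show ?thesis using a eq by simp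
    qed
  qed
qed

lemma start_point_not_next: "i \<ge> 1 \<Longrightarrow> start_point i \<notin> next_point ` inner_points"
proof
  assume i: "i \<ge> 1" and "start_point i \<in> next_point ` inner_points"
  then obtain p where p: "p \<in> inner_points" "next_point p = start_point i" by force
  from p(1) show False
    by (cases rule: next_point_cases) (use p(2) i in \<open>auto simp: start_point_def targets_def\<close>)
qed

lemma start_point_inner:
  assumes "i \<in> {1..n}"
  shows "start_point i \<in> inner_points" "next_point (start_point i) \<noteq> start_point i"
proof -
  show 1: "start_point i \<in> inner_points"
    using assms by (auto simp: start_point_def path_region_def path_ends_def end_point_def)
  then show "next_point (start_point i) \<noteq> start_point i"
    using start_point_not_next[of i] assms by (metis atLeastAtMost_iff imageI)
qed

text \<open>An orbit that leaves its first point never stops at a fixed point, as that point would have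
  a second preimage. Its abscissa increases and is bounded, so it arrives at an end point.\<close>

lemma ex_orbit:
  assumes "p \<in> path_region n" "p \<in> path_ends n \<or> next_point p \<noteq> p"
  shows "\<exists>l. l \<noteq> [] \<and> hd l = p \<and> last l \<in> path_ends n \<and> set l \<subseteq> path_region n \<and>
    successively (\<lambda>u v. u \<in> inner_points \<and> v = next_point u) l \<and> successively is_step l"
  using assms
proof (induction "nat (2 * int n - fst p)" arbitrary: p rule: less_induct)
  case less
  show ?case
  proof (cases "p \<in> path_ends n")
    case True
    then show ?thesis using less.prems by (intro exI[of _ "[p]"]) auto
  next
    case False
    let ?q = "next_point p"
    have p: "p \<in> inner_points" "?q \<noteq> p" using less.prems False by auto
    have st: "is_step p ?q" using next_point_step[OF p(1)] p(2) by blast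
    have q: "?q \<in> path_region n" using next_point_in_region[OF p(1)] .
    have "fst p < fst ?q" using is_step_in_right_cone[OF st] by (simp add: in_right_cone_def)
    moreover have "fst p \<le> 2 * int n - 1" using p(1) by (auto simp: path_region_def)
    ultimately have "nat (2 * int n - fst ?q) < nat (2 * int n - fst p)" by simp
    moreover have "?q \<in> path_ends n \<or> next_point ?q \<noteq> ?q"
      using inj_onD[OF inj_on_next_point, of ?q p] p q by auto
    ultimately obtain l where l: "l \<noteq> []" "hd l = ?q" "last l \<in> path_ends n" "set l \<subseteq> path_region n"
      "successively (\<lambda>u v. u \<in> inner_points \<and> v = next_point u) l" "successively is_step l"
      using less.hyps[of ?q] q by blast
    then show ?thesis using p st
      by (intro exI[of _ "p # l"]) (auto simp: successively_Cons)
  qed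
qed

end

text \<open>The orbits of the start points are disjoint because two orbits of an injective map that meet
  are nested and no start point is in the range of the map. By planarity they end in the right order. No
  other point can move: its orbit would arrive at an end point, hence join one of these paths.\<close>

lemma matching_of_paths_surj:
  assumes \<sigma>: "\<sigma> \<in> step_matchings n"
  shows "\<exists>\<pi>\<in>nonintersecting_path_tuples n. matching_of_paths n \<pi> = \<sigma>"
proof -
  interpret step_matching n \<sigma> by standard (rule \<sigma>)
  define orbit where "orbit p l \<longleftrightarrow> l \<noteq> [] \<and> hd l = p \<and> last l \<in> path_ends n \<and> set l \<subseteq> path_region n \<and>
    successively (\<lambda>u v. u \<in> inner_points \<and> v = next_point u) l \<and> successively is_step l" for p l
  have "\<exists>l. orbit (start_point i) l" if "i \<in> {1..n}" for i
    using ex_orbit start_point_inner[OF that] unfolding orbit_def by blast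
  then obtain L where L: "\<And>i. i \<in> {1..n} \<Longrightarrow> orbit (start_point i) (L i)" by metis
  have LD: "L i \<noteq> []" "hd (L i) = start_point i" "last (L i) \<in> path_ends n"
    "set (L i) \<subseteq> path_region n"
    "successively (\<lambda>u v. u \<in> inner_points \<and> v = next_point u) (L i)"
    "successively is_step (L i)" if "i \<in> {1..n}" for i
    using L[OF that] unfolding orbit_def by blast+
  have "\<exists>k\<in>{1..n}. last (L i) = end_point k" if "i \<in> {1..n}" for i
    using LD(3)[OF that] unfolding path_ends_def by blast
  then obtain \<tau> where \<tau>: "\<And>i. i \<in> {1..n} \<Longrightarrow> \<tau> i \<in> {1..n}"
    "\<And>i. i \<in> {1..n} \<Longrightarrow> last (L i) = end_point (\<tau> i)" by metis
  have start: "i = j" if ij: "i \<in> {1..n}" "j \<in> {1..n}" "start_point i \<in> set (L j)" for i j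
  proof -
    have "start_point i = hd (L j)"
      using orbit_initial_point[OF LD(5)[OF ij(2)] ij(3)] start_point_not_next[of i] ij(1) by simp
    then show ?thesis using LD(2)[OF ij(2)] by (simp add: start_point_def)
  qed
  have disj: "set (L i) \<inter> set (L j) = {}" if ij: "i \<in> {1..n}" "j \<in> {1..n}" "i \<noteq> j" for i j
  proof (rule ccontr)
    assume "set (L i) \<inter> set (L j) \<noteq> {}"
    then have "start_point i \<in> set (L j) \<or> start_point j \<in> set (L i)"
      using orbits_meet[OF inj_on_next_point LD(5)[OF ij(1)] LD(5)[OF ij(2)]]
        LD(2)[OF ij(1)] LD(2)[OF ij(2)] by simp
    then show False using start ij by blast
  qed
  have above: "\<forall>w\<in>set (L i). 0 \<le> snd w" if "i \<in> {1..n}" for i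
    using LD(4)[OF that] by (auto simp: path_region_def)
  have mono: "\<tau> i < \<tau> j" if ij: "i \<in> {1..n}" "j \<in> {1..n}" "i < j" for i j
  proof -
    obtain p where p: "L i = start_point i # p" using LD(1,2)[OF ij(1)] by (cases "L i") auto
    obtain q where q: "L j = start_point j # q" using LD(1,2)[OF ij(2)] by (cases "L j") auto
    have "fst (last (start_point i # p)) < fst (last (start_point j # q))"
    proof (rule noncrossing)
      show "successively is_step (start_point i # p)" "successively is_step (start_point j # q)"
        using LD(6)[OF ij(1)] LD(6)[OF ij(2)] p q by simp_all
      show "set (start_point i # p) \<inter> set (start_point j # q) = {}"
        using disj[OF ij(1,2)] ij(3) p q by simp
      show "\<forall>w\<in>set (start_point i # p). 0 \<le> snd w" "\<forall>w\<in>set (start_point j # q). 0 \<le> snd w"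
        using above[OF ij(1)] above[OF ij(2)] p q by simp_all
      show "fst (start_point i) \<le> fst (last (start_point j # q))"
        "snd (last (start_point j # q)) = 0" "snd (last (start_point i # p)) = 0"
        using \<tau>(2)[OF ij(1)] \<tau>(2)[OF ij(2)] \<tau>(1)[OF ij(2)] p q
        by (simp_all add: start_point_def end_point_def split del: if_split)
    qed (use ij in \<open>simp_all add: start_point_def\<close>)
    then show ?thesis using \<tau>(2)[OF ij(1)] \<tau>(2)[OF ij(2)] p q
      by (simp add: end_point_def split del: if_split)
  qed
  have last_L: "last (L i) = end_point i" if "i \<in> {1..n}" for i
    using strict_mono_on_self_map_id[of n \<tau> i, OF \<tau>(1) mono that] \<tau>(2)[OF that] by simp
  define \<pi> where "\<pi> = restrict L {1..n}"
  have \<pi>: "\<pi> i = L i" if "i \<in> {1..n}" for i using that by (simp add: \<pi>_def)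
  have schroeder: "large_schroeder_path (L i)" if "i \<in> {1..n}" for i
    unfolding large_schroeder_path_def
    using LD(1,2,6)[OF that] above[OF that] last_L[OF that]
    by (auto simp: start_point_def end_point_def is_step_def[abs_def])
  have tuple: "\<pi> \<in> nonintersecting_path_tuples n"
    unfolding nonintersecting_path_tuples_def mem_Collect_eq
  proof (intro conjI ballI impI)
    show "\<pi> \<in> {1..n} \<rightarrow>\<^sub>E {p. large_schroeder_path p}"
      unfolding \<pi>_def using schroeder by (simp add: restrict_PiE_iff)
    fix i assume i: "i \<in> {1..n}"
    show "path_from_to (\<pi> i) (- 2 * int i + 1, 0) (2 * int i - 1, 0)"
      using LD(2)[OF i] last_L[OF i] \<pi>[OF i]
      by (simp add: path_from_to_def start_point_def end_point_def)
    fix j assume j: "j \<in> {1..n}" and "i \<noteq> j"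
    then show "\<not> paths_intersect (\<pi> i) (\<pi> j)"
      using disj[OF i j] \<pi>[OF i] \<pi>[OF j] by (simp add: paths_intersect_def)
  qed
  interpret P: path_tuple n \<pi> by standard (rule tuple)
  have "matching_of_paths n \<pi> = \<sigma>"
  proof (rule extensionalityI[of _ "sources n"])
    show "matching_of_paths n \<pi> \<in> extensional (sources n)" by (simp add: matching_of_paths_def)
    show "\<sigma> \<in> extensional (sources n)" using step_matchingsD(1)[OF \<sigma>] .
    fix p assume p: "p \<in> sources n"
    then have next_p: "next_point p = \<sigma> p" by (simp add: extend_matching_def)
    from p show "matching_of_paths n \<pi> p = \<sigma> p"
    proof (cases rule: P.matching_of_paths_cases)
      case (1 i)
      then show ?thesis using consecutive_successively[OF _ LD(5)[OF 1(1)]] \<pi>[OF 1(1)] next_p by simp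
    next
      case 2
      have off: "p \<notin> set (L i)" if "i \<in> {1..n}" for i using 2(1)[OF that] \<pi>[OF that] by simp
      have "\<sigma> p = p"
      proof (rule ccontr)
        assume "\<sigma> p \<noteq> p"
        then obtain l where l: "orbit p l"
          using ex_orbit[of p] p sources_subset_region next_p unfolding orbit_def by fastforce
        then have ln: "l \<noteq> []" "hd l = p" "successively (\<lambda>u v. u \<in> inner_points \<and> v = next_point u) l"
          unfolding orbit_def by blast+
        obtain k where k: "k \<in> {1..n}" "last l = end_point k"
          using l unfolding orbit_def path_ends_def by blast
        then have "set l \<inter> set (L k) \<noteq> {}"
          using last_L[OF k(1)] last_in_set[OF ln(1)] last_in_set[OF LD(1)[OF k(1)]] by auto
        then have "p \<in> set (L k) \<or> start_point k \<in> set l"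
          using orbits_meet[OF inj_on_next_point ln(3) LD(5)[OF k(1)]] ln(2) LD(2)[OF k(1)] by simp
        then have "start_point k \<in> set l" using off[OF k(1)] by blast
        then have "start_point k = p"
          using orbit_initial_point[OF ln(3)] start_point_not_next[of k] k(1) ln(2) by simp
        then show False using off[OF k(1)] hd_in_set[OF LD(1)[OF k(1)]] LD(2)[OF k(1)] by simp
      qed
      with 2(2) show ?thesis by simp
    qed
  qed
  with tuple show ?thesis by blast
qed

lemma bij_betw_matching_of_paths:
  "bij_betw (matching_of_paths n) (nonintersecting_path_tuples n) (step_matchings n)"
proof (rule bij_betw_imageI[OF inj_on_matching_of_paths])
  have "matching_of_paths n \<pi> \<in> step_matchings n" if "\<pi> \<in> nonintersecting_path_tuples n" for \<pi>
  proof -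
    interpret path_tuple n \<pi> by standard (rule that)
    show ?thesis by (rule matching_of_paths_step_matching)
  qed
  then show "matching_of_paths n ` nonintersecting_path_tuples n = step_matchings n"
    using matching_of_paths_surj[of _ n] by (auto simp: image_iff)
qed

section \<open>The bijection\<close>

theorem proposition2p2:
  fixes n :: nat
  assumes "n \<ge> 1"
  shows "\<exists>f. bij_betw f {T. is_domino_tiling (aztec_diamond n) T} (nonintersecting_path_tuples n)"
  using bij_betw_trans[OF bij_betw_inv_into[OF bij_betw_tiling_of]
      bij_betw_inv_into[OF bij_betw_matching_of_paths]] by blast

end
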